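(* Let $(M,g)$ be a $2$-dimensional Riemannian manifold admitting a non-trivial (i.e. not identically zero) smooth tangent vector field $X$. Let $M_0=\{x\in M : X(x)\neq 0\}$ be the open subset of $M$ outside the zeroes of $X$, and on $M_0$ define the unit smooth vector field $\mathcal{T}=X/g(X,X)^{1/2}$. Then the smooth tangent vector field $Y$ on $M_0$ given by $$Y=\nabla_{\mathcal{T}}\mathcal{T}-\mathrm{div}(\mathcal{T})\,\mathcal{T}$$ satisfies $$K=\mathrm{div}(Y)\quad\text{on } M_0,$$ where $K$ is the Gauss curvature of $g$.
   Context: $\nabla$ denotes the Levi-Civita connection of $g$, and $\mathrm{div}$ denotes the divergence with respect to $g$, i.e. $\mathrm{div}(V)$ is the trace of the linear operator $v\mapsto\nabla_v V$ on each tangent space. The Gauss curvature $K$ is normalized so that the Ricci tensor satisfies $\mathrm{Ric}(V,W)=K\,g(V,W)$ for all tangent vector fields $V,W$ (so the unit round sphere has $K=1$). *)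

theory Defs
  imports "HOL-Analysis.Analysis" "HOL-Library.Function_Algebras"
begin

text \<open>Tangent vectors are functionals on real-valued functions, so the tangent spaces are
  linear subspaces of the following pointwise real vector space structure.\<close>

instantiation "fun" :: (type, real_vector) real_vector
begin

definition scaleR_fun :: "real \<Rightarrow> ('a \<Rightarrow> 'b) \<Rightarrow> 'a \<Rightarrow> 'b"
  where "scaleR_fun c f = (\<lambda>x. c *\<^sub>R f x)"

instance
  by standard (simp_all add: scaleR_fun_def fun_eq_iff scaleR_add_right scaleR_add_left)

end


section \<open>Smooth maps between Euclidean spaces\<close>

text \<open>Only meaningful on open sets \<open>S\<close>.\<close>

primrec Ck_on ::
  "nat \<Rightarrow> 'a::euclidean_space set \<Rightarrow> ('a \<Rightarrow> 'b::real_normed_vector) \<Rightarrow> bool" where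
  "Ck_on 0 S f \<longleftrightarrow> continuous_on S f"
| "Ck_on (Suc k) S f \<longleftrightarrow>
    (\<exists>f'. (\<forall>x\<in>S. (f has_derivative f' x) (at x)) \<and> (\<forall>v. Ck_on k S (\<lambda>x. f' x v)))"

definition smooth_map_on :: "'a::euclidean_space set \<Rightarrow> ('a \<Rightarrow> 'b::real_normed_vector) \<Rightarrow> bool"
  where "smooth_map_on S f \<longleftrightarrow> (\<forall>k. Ck_on k S f)"


section \<open>Smooth manifolds\<close>

text \<open>A chart is a domain together with a coordinate map, whose values outside the domain are
  irrelevant. The atlas need not be maximal. The dimension is that of the model space \<open>'e\<close>.\<close>

type_synonym ('m, 'e) chart = "'m set \<times> ('m \<Rightarrow> 'e)"

definition smooth_manifold :: "'m topology \<Rightarrow> ('m, 'e::euclidean_space) chart set \<Rightarrow> bool" where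
  "smooth_manifold M \<A> \<longleftrightarrow>
     Hausdorff_space M \<and> second_countable M \<and>
     topspace M = (\<Union>(D, \<phi>)\<in>\<A>. D) \<and>
     (\<forall>(D, \<phi>)\<in>\<A>. openin M D \<and> open (\<phi> ` D) \<and>
        homeomorphic_map (subtopology M D) (top_of_set (\<phi> ` D)) \<phi>) \<and>
     (\<forall>(D, \<phi>)\<in>\<A>. \<forall>(E, \<psi>)\<in>\<A>. smooth_map_on (\<phi> ` (D \<inter> E)) (\<psi> \<circ> inv_into D \<phi>))"

definition smooth_fun_on ::
  "'m topology \<Rightarrow> ('m, 'e::euclidean_space) chart set \<Rightarrow> 'm set \<Rightarrow> ('m \<Rightarrow> real) \<Rightarrow> bool" where
  "smooth_fun_on M \<A> U f \<longleftrightarrow>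
     openin M U \<and> (\<forall>(D, \<phi>)\<in>\<A>. smooth_map_on (\<phi> ` (D \<inter> U)) (f \<circ> inv_into D \<phi>))"

definition smooth_fun_near ::
  "'m topology \<Rightarrow> ('m, 'e::euclidean_space) chart set \<Rightarrow> 'm \<Rightarrow> ('m \<Rightarrow> real) \<Rightarrow> bool" where
  "smooth_fun_near M \<A> p f \<longleftrightarrow> (\<exists>U. p \<in> U \<and> smooth_fun_on M \<A> U f)"


section \<open>Tangent vectors and vector fields\<close>

type_synonym 'm tvec = "('m \<Rightarrow> real) \<Rightarrow> real"

text \<open>The directional derivative at \<open>p\<close> with coordinates \<open>u\<close> in the chart \<open>(D, \<phi>)\<close>, that is
  \<open>\<Sum>i. u\<^sub>i \<partial>/\<partial>x\<^sub>i\<close>, acting on functions smooth near \<open>p\<close>. The value \<open>0\<close> on all other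
  functions makes equality and linear operations those of functionals on smooth germs.\<close>

definition chart_tvec ::
  "'m topology \<Rightarrow> ('m, 'e::euclidean_space) chart set \<Rightarrow> ('m, 'e) chart \<Rightarrow> 'm \<Rightarrow> 'e \<Rightarrow> 'm tvec" where
  "chart_tvec M \<A> = (\<lambda>(D, \<phi>) p u f.
     if smooth_fun_near M \<A> p f
     then frechet_derivative (f \<circ> inv_into D \<phi>) (at (\<phi> p)) u else 0)"

definition tangent_space ::
  "'m topology \<Rightarrow> ('m, 'e::euclidean_space) chart set \<Rightarrow> 'm \<Rightarrow> 'm tvec set" where
  "tangent_space M \<A> p = {chart_tvec M \<A> (D, \<phi>) p u | D \<phi> u. (D, \<phi>) \<in> \<A> \<and> p \<in> D}"

definition smooth_field_on ::
  "'m topology \<Rightarrow> ('m, 'e::euclidean_space) chart set \<Rightarrow> 'm set \<Rightarrow> ('m \<Rightarrow> 'm tvec) \<Rightarrow> bool" where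
  "smooth_field_on M \<A> U V \<longleftrightarrow>
     openin M U \<and> (\<forall>p\<in>U. V p \<in> tangent_space M \<A> p) \<and>
     (\<forall>U' f. U' \<subseteq> U \<and> smooth_fun_on M \<A> U' f \<longrightarrow> smooth_fun_on M \<A> U' (\<lambda>p. V p f))"

definition smooth_field_near ::
  "'m topology \<Rightarrow> ('m, 'e::euclidean_space) chart set \<Rightarrow> 'm \<Rightarrow> ('m \<Rightarrow> 'm tvec) \<Rightarrow> bool" where
  "smooth_field_near M \<A> p V \<longleftrightarrow> (\<exists>U. p \<in> U \<and> smooth_field_on M \<A> U V)"

definition lie_bracket ::
  "'m topology \<Rightarrow> ('m, 'e::euclidean_space) chart set \<Rightarrow>
     ('m \<Rightarrow> 'm tvec) \<Rightarrow> ('m \<Rightarrow> 'm tvec) \<Rightarrow> 'm \<Rightarrow> 'm tvec" where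
  "lie_bracket M \<A> V W p = (\<lambda>f.
     if smooth_fun_near M \<A> p f then V p (\<lambda>q. W q f) - W p (\<lambda>q. V q f) else 0)"


section \<open>Riemannian metrics and the Levi-Civita connection\<close>

definition riemannian_metric ::
  "'m topology \<Rightarrow> ('m, 'e::euclidean_space) chart set \<Rightarrow>
     ('m \<Rightarrow> 'm tvec \<Rightarrow> 'm tvec \<Rightarrow> real) \<Rightarrow> bool" where
  "riemannian_metric M \<A> g \<longleftrightarrow>
     (\<forall>p\<in>topspace M. \<forall>u\<in>tangent_space M \<A> p. \<forall>v\<in>tangent_space M \<A> p.
        g p u v = g p v u \<and>
        (\<forall>w\<in>tangent_space M \<A> p. g p (u + v) w = g p u w + g p v w) \<and>
        (\<forall>c. g p (c *\<^sub>R u) v = c * g p u v)) \<and>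
     (\<forall>p\<in>topspace M. \<forall>v\<in>tangent_space M \<A> p. v \<noteq> 0 \<longrightarrow> g p v v > 0) \<and>
     (\<forall>U V W. smooth_field_on M \<A> U V \<and> smooth_field_on M \<A> U W \<longrightarrow>
        smooth_fun_on M \<A> U (\<lambda>p. g p (V p) (W p)))"

text \<open>\<open>nab p v W\<close> is the covariant derivative of \<open>W\<close> in direction of the tangent vector \<open>v\<close>
  at \<open>p\<close>. It is specified for all fields \<open>W\<close> that are smooth near \<open>p\<close>, and so covers fields
  defined on open subsets of \<open>M\<close> only.\<close>

type_synonym 'm connection = "'m \<Rightarrow> 'm tvec \<Rightarrow> ('m \<Rightarrow> 'm tvec) \<Rightarrow> 'm tvec"

definition affine_connection ::
  "'m topology \<Rightarrow> ('m, 'e::euclidean_space) chart set \<Rightarrow> 'm connection \<Rightarrow> bool" where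
  "affine_connection M \<A> nab \<longleftrightarrow>
     (\<forall>U V W. smooth_field_on M \<A> U V \<and> smooth_field_on M \<A> U W \<longrightarrow>
        smooth_field_on M \<A> U (\<lambda>p. nab p (V p) W)) \<and>
     (\<forall>p\<in>topspace M. \<forall>W. smooth_field_near M \<A> p W \<longrightarrow>
        (\<forall>v\<in>tangent_space M \<A> p. nab p v W \<in> tangent_space M \<A> p) \<and>
        (\<forall>u\<in>tangent_space M \<A> p. \<forall>v\<in>tangent_space M \<A> p.
           nab p (u + v) W = nab p u W + nab p v W) \<and>
        (\<forall>v\<in>tangent_space M \<A> p. \<forall>c. nab p (c *\<^sub>R v) W = c *\<^sub>R nab p v W)) \<and>
     (\<forall>p\<in>topspace M. \<forall>v\<in>tangent_space M \<A> p.
        (\<forall>W Z. smooth_field_near M \<A> p W \<and> smooth_field_near M \<A> p Z \<longrightarrow>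
           nab p v (\<lambda>q. W q + Z q) = nab p v W + nab p v Z) \<and>
        (\<forall>W f. smooth_field_near M \<A> p W \<and> smooth_fun_near M \<A> p f \<longrightarrow>
           nab p v (\<lambda>q. f q *\<^sub>R W q) = v f *\<^sub>R W p + f p *\<^sub>R nab p v W) \<and>
        (\<forall>W Z U. smooth_field_near M \<A> p W \<and> openin M U \<and> p \<in> U \<and> (\<forall>q\<in>U. W q = Z q) \<longrightarrow>
           nab p v W = nab p v Z))"

definition torsion_free ::
  "'m topology \<Rightarrow> ('m, 'e::euclidean_space) chart set \<Rightarrow> 'm connection \<Rightarrow> bool" where
  "torsion_free M \<A> nab \<longleftrightarrow>
     (\<forall>p\<in>topspace M. \<forall>V W. smooth_field_near M \<A> p V \<and> smooth_field_near M \<A> p W \<longrightarrow>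
        nab p (V p) W - nab p (W p) V = lie_bracket M \<A> V W p)"

definition metric_compatible ::
  "'m topology \<Rightarrow> ('m, 'e::euclidean_space) chart set \<Rightarrow>
     ('m \<Rightarrow> 'm tvec \<Rightarrow> 'm tvec \<Rightarrow> real) \<Rightarrow> 'm connection \<Rightarrow> bool" where
  "metric_compatible M \<A> g nab \<longleftrightarrow>
     (\<forall>p\<in>topspace M. \<forall>v\<in>tangent_space M \<A> p. \<forall>W Z.
        smooth_field_near M \<A> p W \<and> smooth_field_near M \<A> p Z \<longrightarrow>
        v (\<lambda>q. g q (W q) (Z q)) = g p (nab p v W) (Z p) + g p (W p) (nab p v Z))"

definition levi_civita_connection ::
  "'m topology \<Rightarrow> ('m, 'e::euclidean_space) chart set \<Rightarrow>
     ('m \<Rightarrow> 'm tvec \<Rightarrow> 'm tvec \<Rightarrow> real) \<Rightarrow> 'm connection \<Rightarrow> bool" where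
  "levi_civita_connection M \<A> g nab \<longleftrightarrow>
     affine_connection M \<A> nab \<and> torsion_free M \<A> nab \<and> metric_compatible M \<A> g nab"


section \<open>Divergence and curvature\<close>

text \<open>Trace of an endomorphism \<open>L\<close> of a finite-dimensional subspace \<open>S\<close>, computed in any
  basis of \<open>S\<close>.\<close>

definition trace_on :: "'v::real_vector set \<Rightarrow> ('v \<Rightarrow> 'v) \<Rightarrow> real" where
  "trace_on S L = (THE t. \<forall>B. finite B \<and> independent B \<and> span B = S \<longrightarrow>
     t = (\<Sum>b\<in>B. representation B (L b) b))"

definition divergence ::
  "'m topology \<Rightarrow> ('m, 'e::euclidean_space) chart set \<Rightarrow> 'm connection \<Rightarrow>
     ('m \<Rightarrow> 'm tvec) \<Rightarrow> 'm \<Rightarrow> real" where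
  "divergence M \<A> nab V p = trace_on (tangent_space M \<A> p) (\<lambda>v. nab p v V)"

definition curvature_op ::
  "'m topology \<Rightarrow> ('m, 'e::euclidean_space) chart set \<Rightarrow> 'm connection \<Rightarrow>
     ('m \<Rightarrow> 'm tvec) \<Rightarrow> ('m \<Rightarrow> 'm tvec) \<Rightarrow> ('m \<Rightarrow> 'm tvec) \<Rightarrow> 'm \<Rightarrow> 'm tvec" where
  "curvature_op M \<A> nab U V W p =
     nab p (U p) (\<lambda>q. nab q (V q) W) - nab p (V p) (\<lambda>q. nab q (U q) W)
       - nab p (lie_bracket M \<A> U V p) W"

text \<open>The value at \<open>p\<close> of the curvature tensor, computed from any smooth local extensions of
  the three tangent vectors.\<close>

definition riemann_tensor ::
  "'m topology \<Rightarrow> ('m, 'e::euclidean_space) chart set \<Rightarrow> 'm connection \<Rightarrow> 'm \<Rightarrow>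
     'm tvec \<Rightarrow> 'm tvec \<Rightarrow> 'm tvec \<Rightarrow> 'm tvec" where
  "riemann_tensor M \<A> nab p u v w = (THE z. \<forall>U V W.
     smooth_field_near M \<A> p U \<and> smooth_field_near M \<A> p V \<and> smooth_field_near M \<A> p W \<and>
     U p = u \<and> V p = v \<and> W p = w \<longrightarrow> z = curvature_op M \<A> nab U V W p)"

definition ricci_tensor ::
  "'m topology \<Rightarrow> ('m, 'e::euclidean_space) chart set \<Rightarrow> 'm connection \<Rightarrow> 'm \<Rightarrow>
     'm tvec \<Rightarrow> 'm tvec \<Rightarrow> real" where
  "ricci_tensor M \<A> nab p v w =
     trace_on (tangent_space M \<A> p) (\<lambda>u. riemann_tensor M \<A> nab p u v w)"

text \<open>Meaningful in dimension 2, where such a factor exists and is unique at every point.\<close>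

definition gauss_curvature ::
  "'m topology \<Rightarrow> ('m, 'e::euclidean_space) chart set \<Rightarrow>
     ('m \<Rightarrow> 'm tvec \<Rightarrow> 'm tvec \<Rightarrow> real) \<Rightarrow> 'm connection \<Rightarrow> 'm \<Rightarrow> real" where
  "gauss_curvature M \<A> g nab p =
     (THE K. \<forall>v\<in>tangent_space M \<A> p. \<forall>w\<in>tangent_space M \<A> p.
        ricci_tensor M \<A> nab p v w = K * g p v w)"

end

(*
  Complete T locally to an orthonormal frame (T, N) and let omega(v) = g(nabla_v T, N) be its
  connection form, so nabla_v T = omega(v) N and nabla_v N = - omega(v) T.  With a = omega(T) and
  b = omega(N) one finds Y = a N - b T, so div Y = N a - T b - a^2 - b^2.  The curvature
  of the frame is the 2-form d omega, and the structure equation gives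
  d omega (T, N) = T b - N a + a^2 + b^2, which is - K in the sign convention for K.
*)
theory Submission
  imports Defs
begin

section \<open>Calculus of smooth maps\<close>

text \<open>No orientation is given, so a unit field \<open>N\<close> orthogonal to \<open>T\<close>
  need not exist on all of \<open>M0\<close>; it is built only near each point. Its sign ambiguity
  is harmless: replacing \<open>N\<close> by \<open>- N\<close> flips \<open>\<omega>\<close>, and a
  N, b and the curvature expression stay the same. Since rotations of the plane commute, the
  products \<omega>(A) \<omega>(B) cancel in the curvature and \<open>\<omega>\<close> enters it
  only through its exterior derivative. The other obstacle lies in the definite descriptions.
  \<open>trace_on\<close>, \<open>riemann_tensor\<close> and \<open>gauss_curvature\<close>
  determine a value only once existence and uniqueness are shown, the first over all bases, the
  second over all local extensions of three vectors. Evaluating the curvature on \<open>T\<close>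
  and \<open>N\<close> alone would not settle this. It is evaluated on arbitrary smooth fields
  through their frame coefficients, and the outcome depends only on the values at the point, so
  tensoriality is read off from the formula. Extensions come without cutoff functions, because
  fields have to be smooth only near the point.\<close>

lemma Ck_on_cong:
  assumes "open S" "Ck_on k S f" "\<And>x. x \<in> S \<Longrightarrow> f x = h x"
  shows "Ck_on k S h"
proof (cases k)
  case 0
  then show ?thesis using assms continuous_on_cong[of S S f h] by simp
next
  case (Suc j)
  with assms(2) obtain f' where f': "\<And>x. x \<in> S \<Longrightarrow> (f has_derivative f' x) (at x)"
    "\<And>v. Ck_on j S (\<lambda>x. f' x v)" by auto
  \<comment> \<open>Derivatives are taken at the full filter \<open>at x\<close>, so agreement on
    \<open>S\<close> suffices only because \<open>S\<close> is open.\<close>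
  have "(h has_derivative f' x) (at x)" if "x \<in> S" for x
    using has_derivative_transform_within_open[OF f'(1)[OF that] assms(1) that] assms(3) by auto
  with f'(2) Suc show ?thesis by auto
qed

lemma Ck_on_subset:
  assumes "Ck_on k S f" "R \<subseteq> S"
  shows "Ck_on k R f"
  using assms
proof (induction k arbitrary: f)
  case 0
  then show ?case using continuous_on_subset by auto
next
  case (Suc k)
  from Suc.prems(1) obtain f' where "\<forall>x\<in>S. (f has_derivative f' x) (at x)"
    "\<forall>v. Ck_on k S (\<lambda>x. f' x v)" by auto
  then show ?case using Suc.IH Suc.prems(2) by (auto intro!: exI[of _ f'])
qed

lemma Ck_on_SucD:
  assumes "Ck_on (Suc k) S f"
  shows "Ck_on k S f"
  using assms
proof (induction k arbitrary: f)
  case 0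
  then show ?case
    using has_derivative_continuous by (fastforce intro: continuous_at_imp_continuous_on)
next
  case (Suc k)
  from Suc.prems obtain f' where f': "\<forall>x\<in>S. (f has_derivative f' x) (at x)"
    "\<And>v. Ck_on (Suc k) S (\<lambda>x. f' x v)" unfolding Ck_on.simps(2)[of "Suc k"] by auto
  then have "\<And>v. Ck_on k S (\<lambda>x. f' x v)" using Suc.IH by blast
  with f'(1) show ?case by auto
qed

lemma Ck_on_const [simp]: "Ck_on k S (\<lambda>x. c)"
proof (induction k arbitrary: c)
  case (Suc k)
  then show ?case by (auto intro!: exI[of _ "\<lambda>x v. 0"])
qed simp

lemma Ck_on_add:
  assumes "Ck_on k S f" "Ck_on k S h"
  shows "Ck_on k S (\<lambda>x. f x + h x)"
  using assms
proof (induction k arbitrary: f h)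
  case 0
  then show ?case by (auto intro: continuous_on_add)
next
  case (Suc k)
  from Suc.prems obtain f' h' where "\<forall>x\<in>S. (f has_derivative f' x) (at x)"
    "\<forall>v. Ck_on k S (\<lambda>x. f' x v)" "\<forall>x\<in>S. (h has_derivative h' x) (at x)"
    "\<forall>v. Ck_on k S (\<lambda>x. h' x v)" by auto
  then show ?case using Suc.IH
    by (auto intro!: exI[of _ "\<lambda>x v. f' x v + h' x v"] has_derivative_add)
qed

lemma Ck_on_bounded_linear:
  assumes "bounded_linear L" "Ck_on k S f"
  shows "Ck_on k S (\<lambda>x. L (f x))"
  using assms(2)
proof (induction k arbitrary: f)
  case 0
  then show ?case using bounded_linear.continuous_on[OF assms(1)] by auto
next
  case (Suc k)
  from Suc.prems obtain f' where "\<forall>x\<in>S. (f has_derivative f' x) (at x)"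
    "\<forall>v. Ck_on k S (\<lambda>x. f' x v)" by auto
  then show ?case using Suc.IH
    by (auto intro!: exI[of _ "\<lambda>x v. L (f' x v)"] bounded_linear.has_derivative[OF assms(1)])
qed

lemma Ck_on_mult:
  fixes f h :: "'a::euclidean_space \<Rightarrow> real"
  assumes "Ck_on k S f" "Ck_on k S h"
  shows "Ck_on k S (\<lambda>x. f x * h x)"
  using assms
proof (induction k arbitrary: f h)
  case 0
  then show ?case by (auto intro: continuous_on_mult)
next
  case (Suc k)
  from Suc.prems obtain f' h' where *: "\<forall>x\<in>S. (f has_derivative f' x) (at x)"
    "\<And>v. Ck_on k S (\<lambda>x. f' x v)" "\<forall>x\<in>S. (h has_derivative h' x) (at x)"
    "\<And>v. Ck_on k S (\<lambda>x. h' x v)" by auto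
  have "Ck_on k S (\<lambda>x. f x * h' x v + f' x v * h x)" for v
    by (intro Ck_on_add Suc.IH *(2,4) Suc.prems[THEN Ck_on_SucD])
  then show ?case using *(1,3)
    by (auto intro!: exI[of _ "\<lambda>x v. f x * h' x v + f' x v * h x"] has_derivative_mult)
qed

lemma Ck_on_sum:
  assumes "finite I" "\<And>i. i \<in> I \<Longrightarrow> Ck_on k S (f i)"
  shows "Ck_on k S (\<lambda>x. \<Sum>i\<in>I. f i x)"
  using assms by (induction I rule: finite_induct) (auto intro: Ck_on_add)

text \<open>Chain rule by induction on \<open>k\<close>, with \<open>h\<close> fixed and
  \<open>f\<close> varying. The hypotheses control \<open>f'\<close> only in fixed directions,
  whereas the chain rule applies \<open>f' (h x)\<close> to the moving vector
  \<open>h' x v\<close>.\<close>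

lemma Ck_on_compose:
  fixes f :: "'b::euclidean_space \<Rightarrow> real" and h :: "'a::euclidean_space \<Rightarrow> 'b"
  assumes "Ck_on k R f" "Ck_on k S h" "h ` S \<subseteq> R"
  shows "Ck_on k S (\<lambda>x. f (h x))"
  using assms(1,2)
proof (induction k arbitrary: f)
  case 0
  then show ?case using continuous_on_compose2[of R f S h] assms(3) by auto
next
  case (Suc k)
  from Suc.prems obtain f' h' where f': "\<And>x. x \<in> R \<Longrightarrow> (f has_derivative f' x) (at x)"
    "\<And>v. Ck_on k R (\<lambda>x. f' x v)" by auto
  from Suc.prems obtain h' where h': "\<And>x. x \<in> S \<Longrightarrow> (h has_derivative h' x) (at x)"
    "\<And>v. Ck_on k S (\<lambda>x. h' x v)" by auto
  \<comment> \<open>Expanding the moving direction in the basis turns the derivative into a sum of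
    products, each factor of which has a fixed direction and is covered by the induction hypothesis
    or by the regularity of \<open>h\<close>.\<close>
  let ?d = "\<lambda>x v. \<Sum>i\<in>Basis. (h' x v \<bullet> i) * f' (h x) i"
  have "((\<lambda>x. f (h x)) has_derivative ?d x) (at x)" if "x \<in> S" for x
  proof -
    have hx: "h x \<in> R" using that assms(3) by auto
    have lin: "linear (f' (h x))" using f'(1)[OF hx] has_derivative_linear by blast
    have comp: "((\<lambda>x. f (h x)) has_derivative (\<lambda>v. f' (h x) (h' x v))) (at x)"
      using has_derivative_compose[OF h'(1)[OF that] f'(1)[OF hx]] .
    have rep: "f' (h x) w = (\<Sum>i\<in>Basis. (w \<bullet> i) * f' (h x) i)" for w
    proof -
      have "f' (h x) w = f' (h x) (\<Sum>i\<in>Basis. (w \<bullet> i) *\<^sub>R i)"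
        by (simp add: euclidean_representation)
      also have "\<dots> = (\<Sum>i\<in>Basis. (w \<bullet> i) * f' (h x) i)"
        using lin by (simp add: linear_sum linear_cmul)
      finally show ?thesis .
    qed
    have "(\<lambda>v. f' (h x) (h' x v)) = ?d x" by (rule ext) (rule rep)
    with comp show ?thesis by (rule has_derivative_eq_rhs)
  qed
  moreover have "Ck_on k S (\<lambda>x. ?d x v)" for v
  proof (rule Ck_on_sum[OF finite_Basis], rule Ck_on_mult)
    fix i :: 'b
    show "Ck_on k S (\<lambda>x. h' x v \<bullet> i)"
      by (rule Ck_on_bounded_linear[OF bounded_linear_inner_left h'(2)])
    show "Ck_on k S (\<lambda>x. f' (h x) i)"
      by (rule Suc.IH[OF f'(2) Ck_on_SucD[OF Suc.prems(2)]])
  qed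
  ultimately show ?case unfolding Ck_on.simps(2) by (intro exI[of _ ?d]) blast
qed

lemma Ck_on_frechet_derivative:
  assumes "open S" "Ck_on (Suc k) S f"
  shows "\<And>x. x \<in> S \<Longrightarrow> (f has_derivative frechet_derivative f (at x)) (at x)"
    and "Ck_on k S (\<lambda>x. frechet_derivative f (at x) v)"
proof -
  from assms(2) obtain f' where f': "\<And>x. x \<in> S \<Longrightarrow> (f has_derivative f' x) (at x)"
    "\<And>v. Ck_on k S (\<lambda>x. f' x v)" by auto
  have eq: "f' x = frechet_derivative f (at x)" if "x \<in> S" for x
    using frechet_derivative_at[OF f'(1)[OF that]] .
  show "\<And>x. x \<in> S \<Longrightarrow> (f has_derivative frechet_derivative f (at x)) (at x)"
    using f'(1) eq by auto
  show "Ck_on k S (\<lambda>x. frechet_derivative f (at x) v)"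
    by (rule Ck_on_cong[OF assms(1) f'(2)[of v]]) (simp add: eq)
qed

text \<open>The local derivatives come from separate existential witnesses;
  \<open>frechet_derivative\<close> is the one choice that agrees with all of them, so they glue to
  a derivative on \<open>S\<close>.\<close>

lemma Ck_on_local:
  assumes "\<And>x. x \<in> S \<Longrightarrow> \<exists>R. open R \<and> x \<in> R \<and> Ck_on k R f"
  shows "Ck_on k S f"
  using assms
proof (induction k arbitrary: f)
  case 0
  have "isCont f x" if "x \<in> S" for x
    using 0[OF that] by (auto simp: continuous_on_eq_continuous_at)
  then show ?case by (simp add: continuous_at_imp_continuous_on)
next
  case (Suc k)
  have "(f has_derivative frechet_derivative f (at x)) (at x) \<and>
    (\<exists>R. open R \<and> x \<in> R \<and> (\<forall>v. Ck_on k R (\<lambda>x. frechet_derivative f (at x) v)))"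
    if "x \<in> S" for x
  proof -
    from Suc.prems[OF that] obtain R where R: "open R" "x \<in> R" "Ck_on (Suc k) R f" by blast
    show ?thesis using Ck_on_frechet_derivative[OF R(1,3)] R(1,2) by blast
  qed
  moreover from this have "Ck_on k S (\<lambda>x. frechet_derivative f (at x) v)" for v
    by (intro Suc.IH) blast
  ultimately show ?case by (auto intro!: exI[of _ "\<lambda>x. frechet_derivative f (at x)"])
qed

text \<open>The family c x^a is closed under differentiation, so the induction runs with both
  \<open>c\<close> and \<open>a\<close> free. The exponent -1/2 later normalizes vector
  fields.\<close>

lemma Ck_on_powr: "Ck_on k {0<..} (\<lambda>x::real. c * x powr a)"
proof (induction k arbitrary: c a)
  case 0
  have "continuous_on {0<..} (\<lambda>x::real. c * x powr a)"
    by (intro continuous_intros) auto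
  then show ?case by simp
next
  case (Suc k)
  let ?d = "\<lambda>x v. (v * c * a) * x powr (a - 1)"
  have "((\<lambda>x. c * x powr a) has_derivative ?d x) (at x)" if "x > 0" for x :: real
    using DERIV_cmult[OF has_real_derivative_powr[OF that, of a], of c]
    unfolding has_field_derivative_def
    by (rule has_derivative_eq_rhs) (simp add: fun_eq_iff mult_ac)
  then show ?case unfolding Ck_on.simps(2) using Suc.IH
    by (intro exI[of _ ?d]) blast
qed


section \<open>Smooth functions on manifolds\<close>

lemma smooth_fun_on_openin: "smooth_fun_on M \<A> U f \<Longrightarrow> openin M U"
  by (simp add: smooth_fun_on_def)

lemma smooth_fun_nearI: "smooth_fun_on M \<A> U f \<Longrightarrow> p \<in> U \<Longrightarrow> smooth_fun_near M \<A> p f"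
  unfolding smooth_fun_near_def by blast

lemma smooth_field_nearI: "smooth_field_on M \<A> U V \<Longrightarrow> p \<in> U \<Longrightarrow> smooth_field_near M \<A> p V"
  unfolding smooth_field_near_def by blast

lemma smooth_field_on_openin: "smooth_field_on M \<A> U V \<Longrightarrow> openin M U"
  by (simp add: smooth_field_on_def)

locale smooth_atlas =
  fixes M :: "'m topology" and \<A> :: "('m, 'e::euclidean_space) chart set"
  assumes smooth_manifold: "smooth_manifold M \<A>"
begin

lemma chart_openin: "(D, \<phi>) \<in> \<A> \<Longrightarrow> openin M D"
  using smooth_manifold unfolding smooth_manifold_def by blast

lemma chart_homeomorphic:
  "(D, \<phi>) \<in> \<A> \<Longrightarrow> homeomorphic_map (subtopology M D) (top_of_set (\<phi> ` D)) \<phi>"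
  using smooth_manifold unfolding smooth_manifold_def by blast

lemma chart_at: "p \<in> topspace M \<Longrightarrow> \<exists>D \<phi>. (D, \<phi>) \<in> \<A> \<and> p \<in> D"
  using smooth_manifold unfolding smooth_manifold_def by auto

lemma chart_transition:
  "(D, \<phi>) \<in> \<A> \<Longrightarrow> (E, \<psi>) \<in> \<A> \<Longrightarrow> Ck_on k (\<phi> ` (D \<inter> E)) (\<psi> \<circ> inv_into D \<phi>)"
  using smooth_manifold unfolding smooth_manifold_def smooth_map_on_def by blast

lemma chart_inj:
  assumes "(D, \<phi>) \<in> \<A>"
  shows "inj_on \<phi> D"
proof -
  have "topspace M \<inter> D = D" using openin_subset[OF chart_openin[OF assms]] by auto
  then show ?thesis
    using homeomorphic_imp_injective_map[OF chart_homeomorphic[OF assms]] by simp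
qed

lemma inv_chart [simp]: "(D, \<phi>) \<in> \<A> \<Longrightarrow> q \<in> D \<Longrightarrow> inv_into D \<phi> (\<phi> q) = q"
  using chart_inj inv_into_f_f by metis

lemma open_chart_image:
  assumes "(D, \<phi>) \<in> \<A>" "openin M U"
  shows "open (\<phi> ` (D \<inter> U))"
proof -
  have "openin (subtopology M D) (D \<inter> U)"
    using assms(2) openin_subtopology_Int2 by blast
  then have "openin (top_of_set (\<phi> ` D)) (\<phi> ` (D \<inter> U))"
    using homeomorphic_imp_open_map[OF chart_homeomorphic[OF assms(1)]] by (simp add: open_map_def)
  moreover have "open (\<phi> ` D)"
    using smooth_manifold assms(1) unfolding smooth_manifold_def by blast
  ultimately show ?thesis using openin_open_eq by blast
qed

lemma smooth_fun_onD:
  "smooth_fun_on M \<A> U f \<Longrightarrow> (D, \<phi>) \<in> \<A> \<Longrightarrow> Ck_on k (\<phi> ` (D \<inter> U)) (f \<circ> inv_into D \<phi>)"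
  unfolding smooth_fun_on_def smooth_map_on_def by blast

lemma smooth_fun_onI:
  assumes "openin M U"
    and "\<And>D \<phi> k. (D, \<phi>) \<in> \<A> \<Longrightarrow> Ck_on k (\<phi> ` (D \<inter> U)) (\<lambda>x. f (inv_into D \<phi> x))"
  shows "smooth_fun_on M \<A> U f"
  using assms unfolding smooth_fun_on_def smooth_map_on_def comp_def by blast

lemma smooth_fun_on_subset:
  assumes "smooth_fun_on M \<A> U f" "openin M V" "V \<subseteq> U"
  shows "smooth_fun_on M \<A> V f"
proof (rule smooth_fun_onI[OF assms(2)])
  fix D \<phi> k assume "(D, \<phi>) \<in> \<A>"
  from Ck_on_subset[OF smooth_fun_onD[OF assms(1) this], of "\<phi> ` (D \<inter> V)"] assms(3)
  show "Ck_on k (\<phi> ` (D \<inter> V)) (\<lambda>x. f (inv_into D \<phi> x))" by (auto simp: comp_def)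
qed

lemma smooth_fun_on_cong:
  assumes "smooth_fun_on M \<A> U f" "\<And>q. q \<in> U \<Longrightarrow> f q = h q"
  shows "smooth_fun_on M \<A> U h"
proof (rule smooth_fun_onI[OF smooth_fun_on_openin[OF assms(1)]])
  fix D \<phi> k assume D: "(D, \<phi>) \<in> \<A>"
  show "Ck_on k (\<phi> ` (D \<inter> U)) (\<lambda>x. h (inv_into D \<phi> x))"
    by (rule Ck_on_cong[OF open_chart_image[OF D smooth_fun_on_openin[OF assms(1)]]
          smooth_fun_onD[OF assms(1) D]]) (auto simp: D assms(2))
qed

lemma smooth_fun_on_local:
  assumes "openin M U" "\<And>p. p \<in> U \<Longrightarrow> \<exists>V. p \<in> V \<and> smooth_fun_on M \<A> V f"
  shows "smooth_fun_on M \<A> U f"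
proof (intro smooth_fun_onI assms(1) Ck_on_local)
  fix D \<phi> k x assume D: "(D, \<phi>) \<in> \<A>" and "x \<in> \<phi> ` (D \<inter> U)"
  then obtain p where p: "p \<in> D" "p \<in> U" "x = \<phi> p" by auto
  from assms(2)[OF p(2)] obtain V where V: "p \<in> V" "smooth_fun_on M \<A> V f" by auto
  show "\<exists>R. open R \<and> x \<in> R \<and> Ck_on k R (\<lambda>x. f (inv_into D \<phi> x))"
    using open_chart_image[OF D smooth_fun_on_openin[OF V(2)]] smooth_fun_onD[OF V(2) D] p V(1)
    by (intro exI[of _ "\<phi> ` (D \<inter> V)"]) (auto simp: comp_def)
qed

lemma smooth_fun_on_const: "openin M U \<Longrightarrow> smooth_fun_on M \<A> U (\<lambda>q. c)"
  by (intro smooth_fun_onI Ck_on_const)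

lemma smooth_fun_on_add:
  assumes "smooth_fun_on M \<A> U f" "smooth_fun_on M \<A> U h"
  shows "smooth_fun_on M \<A> U (\<lambda>q. f q + h q)"
  using smooth_fun_onD[OF assms(1)] smooth_fun_onD[OF assms(2)]
  by (intro smooth_fun_onI smooth_fun_on_openin[OF assms(1)] Ck_on_add) (auto simp: comp_def)

lemma smooth_fun_on_mult:
  assumes "smooth_fun_on M \<A> U f" "smooth_fun_on M \<A> U h"
  shows "smooth_fun_on M \<A> U (\<lambda>q. f q * h q)"
  using smooth_fun_onD[OF assms(1)] smooth_fun_onD[OF assms(2)]
  by (intro smooth_fun_onI smooth_fun_on_openin[OF assms(1)] Ck_on_mult) (auto simp: comp_def)

lemma smooth_fun_on_minus:
  assumes "smooth_fun_on M \<A> U f"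
  shows "smooth_fun_on M \<A> U (\<lambda>q. - f q)"
  using smooth_fun_on_mult[OF smooth_fun_on_const[OF smooth_fun_on_openin[OF assms], of "-1"] assms]
  by simp

lemma smooth_fun_on_diff:
  assumes "smooth_fun_on M \<A> U f" "smooth_fun_on M \<A> U h"
  shows "smooth_fun_on M \<A> U (\<lambda>q. f q - h q)"
  using smooth_fun_on_add[OF assms(1) smooth_fun_on_minus[OF assms(2)]] by simp

lemma smooth_fun_on_inverse_sqrt:
  assumes f: "smooth_fun_on M \<A> U f" and pos: "\<And>q. q \<in> U \<Longrightarrow> f q > 0"
  shows "smooth_fun_on M \<A> U (\<lambda>q. 1 / sqrt (f q))"
proof -
  have "smooth_fun_on M \<A> U (\<lambda>q. 1 * f q powr (- 1 / 2))"
  proof (rule smooth_fun_onI[OF smooth_fun_on_openin[OF f]])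
    fix D \<phi> k assume D: "(D, \<phi>) \<in> \<A>"
    show "Ck_on k (\<phi> ` (D \<inter> U)) (\<lambda>x. 1 * f (inv_into D \<phi> x) powr (- 1 / 2))"
    proof (rule Ck_on_compose[OF Ck_on_powr])
      show "Ck_on k (\<phi> ` (D \<inter> U)) (\<lambda>x. f (inv_into D \<phi> x))"
        using smooth_fun_onD[OF f D] by (simp add: comp_def)
      show "(\<lambda>x. f (inv_into D \<phi> x)) ` \<phi> ` (D \<inter> U) \<subseteq> {0<..}"
        using D pos by auto
    qed
  qed
  then show ?thesis
  proof (rule smooth_fun_on_cong)
    fix q assume "q \<in> U"
    then have "f q powr (1 / 2) = sqrt (f q)" using pos powr_half_sqrt less_imp_le by metis
    then show "1 * f q powr (- 1 / 2) = 1 / sqrt (f q)"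
      using powr_minus_divide[of "f q" "1 / 2"] by simp
  qed
qed

text \<open>Smoothness includes continuity in charts (\<open>k = 0\<close>), and a chart pulls the
  open preimage back to \<open>M\<close>. This gives openness of \<open>M0\<close> and of the domain
  on which a field can be normalized.\<close>

lemma openin_smooth_fun_pos:
  assumes f: "smooth_fun_on M \<A> U f"
  shows "openin M {q \<in> U. f q > 0}"
proof (subst openin_subopen, safe)
  fix p assume p: "p \<in> U" "f p > 0"
  note U = smooth_fun_on_openin[OF f]
  then have "p \<in> topspace M" using p openin_subset by blast
  then obtain D \<phi> where D: "(D, \<phi>) \<in> \<A>" "p \<in> D" using chart_at by blast
  let ?S = "\<phi> ` (D \<inter> U)" and ?F = "f \<circ> inv_into D \<phi>"
  have S: "open ?S" by (rule open_chart_image[OF D(1) U])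
  have cont: "continuous_on ?S ?F" using smooth_fun_onD[OF f D(1), of 0] by simp
  have "open (?F -` {0<..} \<inter> ?S)"
    by (rule continuous_on_open_vimage[OF S, THEN iffD1, rule_format, OF cont open_greaterThan])
  then have op: "openin euclidean (?F -` {0<..} \<inter> ?S)" by (rule open_openin[THEN iffD1])
  have top: "topspace (subtopology M D) = D"
    using openin_subset[OF chart_openin[OF D(1)]] by auto
  have "continuous_map (subtopology M D) euclidean \<phi>"
    using homeomorphic_imp_continuous_map[OF chart_homeomorphic[OF D(1)]]
    by (simp add: continuous_map_in_subtopology)
  from openin_continuous_map_preimage[OF this op]
  have "openin (subtopology M D) {q \<in> D. \<phi> q \<in> ?F -` {0<..} \<inter> ?S}" unfolding top .
  from openin_trans_full[OF this chart_openin[OF D(1)]]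
  have "openin M {q \<in> D. \<phi> q \<in> ?F -` {0<..} \<inter> ?S}" .
  moreover have "{q \<in> D. \<phi> q \<in> ?F -` {0<..} \<inter> ?S} \<subseteq> {q \<in> U. 0 < f q}"
  proof
    fix q assume "q \<in> {q \<in> D. \<phi> q \<in> ?F -` {0<..} \<inter> ?S}"
    then obtain r where q: "q \<in> D" "0 < ?F (\<phi> q)" and r: "\<phi> q = \<phi> r" "r \<in> D" "r \<in> U"
      by auto
    with chart_inj[OF D(1)] have "q = r" by (auto dest: inj_onD)
    with q r D(1) show "q \<in> {q \<in> U. 0 < f q}" by simp
  qed
  moreover have "p \<in> {q \<in> D. \<phi> q \<in> ?F -` {0<..} \<inter> ?S}" using D p by auto
  ultimately show "\<exists>R. openin M R \<and> p \<in> R \<and> R \<subseteq> {q \<in> U. 0 < f q}" by blast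
qed


section \<open>Tangent vectors\<close>

lemma chart_tvec_apply:
  "smooth_fun_near M \<A> p f \<Longrightarrow>
    chart_tvec M \<A> (D, \<phi>) p u f = frechet_derivative (f \<circ> inv_into D \<phi>) (at (\<phi> p)) u"
  by (simp add: chart_tvec_def)

lemma has_derivative_chart:
  assumes "smooth_fun_near M \<A> p f" "(D, \<phi>) \<in> \<A>" "p \<in> D"
  shows "((f \<circ> inv_into D \<phi>) has_derivative
    frechet_derivative (f \<circ> inv_into D \<phi>) (at (\<phi> p))) (at (\<phi> p))"
proof -
  from assms(1) obtain U where U: "p \<in> U" "smooth_fun_on M \<A> U f"
    unfolding smooth_fun_near_def by auto
  show ?thesis
    by (rule Ck_on_frechet_derivative(1)[OF open_chart_image[OF assms(2) smooth_fun_on_openin[OF U(2)]]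
          smooth_fun_onD[OF U(2) assms(2)]]) (use U(1) assms(3) in auto)
qed

lemma chart_tvec_eqI:
  assumes "smooth_fun_near M \<A> p f"
    and "((f \<circ> inv_into D \<phi>) has_derivative F) (at (\<phi> p))"
  shows "chart_tvec M \<A> (D, \<phi>) p u f = F u"
  using frechet_derivative_at[OF assms(2)] chart_tvec_apply[OF assms(1)] by metis

lemma linear_chart_tvec:
  assumes "(D, \<phi>) \<in> \<A>" "p \<in> D"
  shows "linear (chart_tvec M \<A> (D, \<phi>) p)"
proof -
  have lin: "linear (\<lambda>u. chart_tvec M \<A> (D, \<phi>) p u f)" for f
  proof (cases "smooth_fun_near M \<A> p f")
    case True
    show ?thesis
      using has_derivative_linear[OF has_derivative_chart[OF True assms]]
      by (simp add: chart_tvec_apply[OF True])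
  next
    \<comment> \<open>The default value 0 on functions that are not smooth near \<open>p\<close>
      keeps the evaluation linear for these \<open>f\<close> as well.\<close>
    case False
    then show ?thesis by (simp add: chart_tvec_def linear_zero)
  qed
  show ?thesis
    by (rule linearI) (auto simp: fun_eq_iff scaleR_fun_def linear_add[OF lin] linear_cmul[OF lin])
qed

text \<open>The chain rule: \<open>w\<close> is the image of \<open>u\<close> under the derivative
  at \<open>\<psi> p\<close> of the transition map from the \<open>\<psi>\<close> to the
  \<open>\<phi>\<close> coordinates.\<close>

lemma chart_tvec_change:
  assumes D: "(D, \<phi>) \<in> \<A>" "p \<in> D" and E: "(E, \<psi>) \<in> \<A>" "p \<in> E"
  shows "\<exists>w. chart_tvec M \<A> (E, \<psi>) p u = chart_tvec M \<A> (D, \<phi>) p w"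
proof -
  let ?h = "\<phi> \<circ> inv_into E \<psi>"
  have S: "open (\<psi> ` (E \<inter> D))" by (rule open_chart_image[OF E(1) chart_openin[OF D(1)]])
  have pS: "\<psi> p \<in> \<psi> ` (E \<inter> D)" using D E by auto
  have hp: "?h (\<psi> p) = \<phi> p" using E by simp
  have h: "(?h has_derivative frechet_derivative ?h (at (\<psi> p))) (at (\<psi> p))"
    by (rule Ck_on_frechet_derivative(1)[OF S chart_transition[OF E(1) D(1)] pS])
  have "chart_tvec M \<A> (E, \<psi>) p u f = chart_tvec M \<A> (D, \<phi>) p (frechet_derivative ?h (at (\<psi> p)) u) f"
    for f
  proof (cases "smooth_fun_near M \<A> p f")
    case True
    let ?F = "f \<circ> inv_into D \<phi>"
    have "(?F has_derivative frechet_derivative ?F (at (\<phi> p))) (at (?h (\<psi> p)))"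
      using has_derivative_chart[OF True D] hp by simp
    from diff_chain_at[OF h this]
    have "((?F \<circ> ?h) has_derivative frechet_derivative ?F (at (\<phi> p)) \<circ> frechet_derivative ?h (at (\<psi> p)))
      (at (\<psi> p))" .
    then have "((f \<circ> inv_into E \<psi>) has_derivative
        frechet_derivative ?F (at (\<phi> p)) \<circ> frechet_derivative ?h (at (\<psi> p))) (at (\<psi> p))"
      by (rule has_derivative_transform_within_open[OF _ S pS]) (use D E in auto)
    from chart_tvec_eqI[OF True this] show ?thesis by (simp add: chart_tvec_apply[OF True])
  next
    case False
    then show ?thesis by (simp add: chart_tvec_def)
  qed
  then show ?thesis by blast
qed

text \<open>\<open>tangent_space\<close> collects vectors from all charts around \<open>p\<close>.
  That one chart already yields all of them makes it a linear image of the model space, hence a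
  subspace.\<close>

lemma tangent_space_eq_range:
  assumes "(D, \<phi>) \<in> \<A>" "p \<in> D"
  shows "tangent_space M \<A> p = range (chart_tvec M \<A> (D, \<phi>) p)"
  using chart_tvec_change[OF assms] assms unfolding tangent_space_def by blast

lemma smooth_coordinate:
  assumes "(D, \<phi>) \<in> \<A>"
  shows "smooth_fun_on M \<A> D (\<lambda>q. \<phi> q \<bullet> i)"
  using Ck_on_bounded_linear[OF bounded_linear_inner_left chart_transition[OF _ assms]]
  by (intro smooth_fun_onI chart_openin[OF assms]) (auto simp: comp_def)

text \<open>The coordinate functions are smooth near \<open>p\<close>, and applying the tangent
  vector to them returns the components of \<open>u\<close>. This keeps a vector chosen off a line
  in coordinates off that line in the tangent space.\<close>

lemma inj_chart_tvec:
  assumes D: "(D, \<phi>) \<in> \<A>" "p \<in> D"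
  shows "inj (chart_tvec M \<A> (D, \<phi>) p)"
proof (rule injI, rule euclidean_eqI)
  fix u v i assume eq: "chart_tvec M \<A> (D, \<phi>) p u = chart_tvec M \<A> (D, \<phi>) p v"
  let ?f = "\<lambda>q. \<phi> q \<bullet> i"
  have f: "smooth_fun_near M \<A> p ?f"
    by (rule smooth_fun_nearI[OF smooth_coordinate[OF D(1)] D(2)])
  have "((\<lambda>x. x \<bullet> i) has_derivative (\<lambda>x. x \<bullet> i)) (at (\<phi> p))"
    by (rule bounded_linear_imp_has_derivative[OF bounded_linear_inner_left])
  then have "((?f \<circ> inv_into D \<phi>) has_derivative (\<lambda>x. x \<bullet> i)) (at (\<phi> p))"
    by (rule has_derivative_transform_within_open[OF _ open_chart_image[OF D(1) chart_openin[OF D(1)]]])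
      (use D in auto)
  from chart_tvec_eqI[OF f this, of u] chart_tvec_eqI[OF f this, of v]
  show "u \<bullet> i = v \<bullet> i" by (simp add: eq)
qed

lemma subspace_tangent_space:
  assumes "p \<in> topspace M"
  shows "subspace (tangent_space M \<A> p)"
proof -
  obtain D \<phi> where D: "(D, \<phi>) \<in> \<A>" "p \<in> D" using chart_at[OF assms] by blast
  show ?thesis unfolding tangent_space_eq_range[OF D]
    by (rule linear_subspace_image[OF linear_chart_tvec[OF D] subspace_UNIV])
qed

lemma smooth_fun_near_ring:
  assumes "smooth_fun_near M \<A> p f" "smooth_fun_near M \<A> p h"
  shows smooth_fun_near_add: "smooth_fun_near M \<A> p (\<lambda>q. f q + h q)"
    and smooth_fun_near_mult: "smooth_fun_near M \<A> p (\<lambda>q. f q * h q)"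
proof -
  from assms obtain U V where UV: "p \<in> U \<inter> V" "smooth_fun_on M \<A> U f" "smooth_fun_on M \<A> V h"
    unfolding smooth_fun_near_def by auto
  have op: "openin M (U \<inter> V)"
    using UV(2,3) by (intro openin_Int smooth_fun_on_openin)
  have "smooth_fun_on M \<A> (U \<inter> V) f" "smooth_fun_on M \<A> (U \<inter> V) h"
    using smooth_fun_on_subset[OF UV(2) op] smooth_fun_on_subset[OF UV(3) op] by auto
  then show "smooth_fun_near M \<A> p (\<lambda>q. f q + h q)" "smooth_fun_near M \<A> p (\<lambda>q. f q * h q)"
    by (intro smooth_fun_nearI[OF _ UV(1)] smooth_fun_on_add smooth_fun_on_mult; simp)+
qed

lemma tangent_add:
  assumes "v \<in> tangent_space M \<A> p" "smooth_fun_near M \<A> p f" "smooth_fun_near M \<A> p h"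
  shows "v (\<lambda>q. f q + h q) = v f + v h"
proof -
  from assms(1) obtain D \<phi> u where D: "(D, \<phi>) \<in> \<A>" "p \<in> D" and v: "v = chart_tvec M \<A> (D, \<phi>) p u"
    unfolding tangent_space_def by auto
  have "(((\<lambda>q. f q + h q) \<circ> inv_into D \<phi>) has_derivative
      (\<lambda>u. frechet_derivative (f \<circ> inv_into D \<phi>) (at (\<phi> p)) u +
        frechet_derivative (h \<circ> inv_into D \<phi>) (at (\<phi> p)) u)) (at (\<phi> p))"
    using has_derivative_add[OF has_derivative_chart[OF assms(2) D] has_derivative_chart[OF assms(3) D]]
    by (simp add: comp_def)
  from chart_tvec_eqI[OF smooth_fun_near_add[OF assms(2,3)] this] show ?thesis
    by (simp add: v chart_tvec_apply assms(2,3))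
qed

lemma tangent_mult:
  assumes "v \<in> tangent_space M \<A> p" "smooth_fun_near M \<A> p f" "smooth_fun_near M \<A> p h"
  shows "v (\<lambda>q. f q * h q) = v f * h p + f p * v h"
proof -
  from assms(1) obtain D \<phi> u where D: "(D, \<phi>) \<in> \<A>" "p \<in> D" and v: "v = chart_tvec M \<A> (D, \<phi>) p u"
    unfolding tangent_space_def by auto
  have "(((\<lambda>q. f q * h q) \<circ> inv_into D \<phi>) has_derivative
      (\<lambda>u. f p * frechet_derivative (h \<circ> inv_into D \<phi>) (at (\<phi> p)) u +
        frechet_derivative (f \<circ> inv_into D \<phi>) (at (\<phi> p)) u * h p)) (at (\<phi> p))"
    using has_derivative_mult[OF has_derivative_chart[OF assms(2) D] has_derivative_chart[OF assms(3) D]] D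
    by (simp add: comp_def)
  from chart_tvec_eqI[OF smooth_fun_near_mult[OF assms(2,3)] this] show ?thesis
    by (simp add: v chart_tvec_apply assms(2,3))
qed

lemma tangent_const:
  assumes "v \<in> tangent_space M \<A> p"
  shows "v (\<lambda>q. c) = 0"
proof -
  from assms obtain D \<phi> u where D: "(D, \<phi>) \<in> \<A>" "p \<in> D" and v: "v = chart_tvec M \<A> (D, \<phi>) p u"
    unfolding tangent_space_def by auto
  have c: "smooth_fun_near M \<A> p (\<lambda>q. c)"
    by (rule smooth_fun_nearI[OF smooth_fun_on_const[OF chart_openin[OF D(1)]] D(2)])
  have "(((\<lambda>q. c) \<circ> inv_into D \<phi>) has_derivative (\<lambda>u. 0)) (at (\<phi> p))"
    by (simp add: comp_def)
  from chart_tvec_eqI[OF c this] show ?thesis by (simp add: v)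
qed

text \<open>Tangent vectors take whole functions as arguments; this lemma makes them see germs only.
  It lets identities that hold merely on an open set, such as g(T, T) = 1, be
  differentiated.\<close>

lemma tangent_local:
  assumes "v \<in> tangent_space M \<A> p" "smooth_fun_on M \<A> U f" "p \<in> U" "\<And>q. q \<in> U \<Longrightarrow> f q = h q"
  shows "v f = v h"
proof -
  from assms(1) obtain D \<phi> u where D: "(D, \<phi>) \<in> \<A>" "p \<in> D" and v: "v = chart_tvec M \<A> (D, \<phi>) p u"
    unfolding tangent_space_def by auto
  have f: "smooth_fun_near M \<A> p f" by (rule smooth_fun_nearI[OF assms(2,3)])
  have h: "smooth_fun_near M \<A> p h"
    by (rule smooth_fun_nearI[OF smooth_fun_on_cong[OF assms(2,4)] assms(3)])
  have "((h \<circ> inv_into D \<phi>) has_derivative frechet_derivative (f \<circ> inv_into D \<phi>) (at (\<phi> p))) (at (\<phi> p))"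
    by (rule has_derivative_transform_within_open[OF has_derivative_chart[OF f D]
          open_chart_image[OF D(1) smooth_fun_on_openin[OF assms(2)]]]) (use D assms in auto)
  from chart_tvec_eqI[OF h this] show ?thesis by (simp add: v chart_tvec_apply f)
qed


section \<open>Vector fields\<close>

lemma smooth_field_onD:
  assumes "smooth_field_on M \<A> U V"
  shows "p \<in> U \<Longrightarrow> V p \<in> tangent_space M \<A> p"
    and "smooth_fun_on M \<A> U f \<Longrightarrow> smooth_fun_on M \<A> U (\<lambda>p. V p f)"
  using assms unfolding smooth_field_on_def by blast+

lemma smooth_field_on_subset:
  assumes "smooth_field_on M \<A> U V" "openin M U'" "U' \<subseteq> U"
  shows "smooth_field_on M \<A> U' V"
  using assms unfolding smooth_field_on_def by blast

lemma smooth_field_on_cong: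
  assumes "smooth_field_on M \<A> U V" "\<And>q. q \<in> U \<Longrightarrow> V q = W q"
  shows "smooth_field_on M \<A> U W"
  unfolding smooth_field_on_def
proof (intro conjI ballI allI impI; (elim conjE)?)
  show "openin M U" using assms smooth_field_on_openin by blast
  show "\<And>p. p \<in> U \<Longrightarrow> W p \<in> tangent_space M \<A> p" using assms smooth_field_onD(1) by metis
  fix U' f assume *: "U' \<subseteq> U" "smooth_fun_on M \<A> U' f"
  have "smooth_fun_on M \<A> U' (\<lambda>p. V p f)" using assms(1) * unfolding smooth_field_on_def by blast
  then show "smooth_fun_on M \<A> U' (\<lambda>p. W p f)"
    by (rule smooth_fun_on_cong) (use * assms(2) in auto)
qed

lemma smooth_field_on_scale:
  assumes V: "smooth_field_on M \<A> U V" and f: "smooth_fun_on M \<A> U f"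
  shows "smooth_field_on M \<A> U (\<lambda>q. f q *\<^sub>R V q)"
  unfolding smooth_field_on_def
proof (intro conjI ballI allI impI; (elim conjE)?)
  show U: "openin M U" using V smooth_field_on_openin by blast
  show "f p *\<^sub>R V p \<in> tangent_space M \<A> p" if "p \<in> U" for p
    using subspace_scale[OF subspace_tangent_space smooth_field_onD(1)[OF V that]] openin_subset[OF U]
      that by auto
  fix U' h assume *: "U' \<subseteq> U" "smooth_fun_on M \<A> U' h"
  have "smooth_fun_on M \<A> U' (\<lambda>p. f p * V p h)"
    using V * by (intro smooth_fun_on_mult smooth_fun_on_subset[OF f] smooth_fun_on_openin[OF *(2)])
      (auto simp: smooth_field_on_def)
  then show "smooth_fun_on M \<A> U' (\<lambda>p. (f p *\<^sub>R V p) h)" by (simp add: scaleR_fun_def)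
qed

lemma smooth_field_on_add:
  assumes V: "smooth_field_on M \<A> U V" and W: "smooth_field_on M \<A> U W"
  shows "smooth_field_on M \<A> U (\<lambda>q. V q + W q)"
  unfolding smooth_field_on_def
proof (intro conjI ballI allI impI; (elim conjE)?)
  show U: "openin M U" using V smooth_field_on_openin by blast
  show "V p + W p \<in> tangent_space M \<A> p" if "p \<in> U" for p
    using subspace_add[OF subspace_tangent_space smooth_field_onD(1)[OF V that]
        smooth_field_onD(1)[OF W that]] openin_subset[OF U] that by auto
  fix U' h assume *: "U' \<subseteq> U" "smooth_fun_on M \<A> U' h"
  have "smooth_fun_on M \<A> U' (\<lambda>p. V p h + W p h)"
    using V W * by (intro smooth_fun_on_add) (auto simp: smooth_field_on_def)
  then show "smooth_fun_on M \<A> U' (\<lambda>p. (V p + W p) h)" by simp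
qed

lemma smooth_field_on_chart_tvec:
  assumes D: "(D, \<phi>) \<in> \<A>"
  shows "smooth_field_on M \<A> D (\<lambda>q. chart_tvec M \<A> (D, \<phi>) q e)"
  unfolding smooth_field_on_def
proof (intro conjI ballI allI impI; (elim conjE)?)
  show "openin M D" by (rule chart_openin[OF D])
  show "chart_tvec M \<A> (D, \<phi>) p e \<in> tangent_space M \<A> p" if "p \<in> D" for p
    using tangent_space_eq_range[OF D that] by blast
  fix U' f assume *: "U' \<subseteq> D" "smooth_fun_on M \<A> U' f"
  note U' = smooth_fun_on_openin[OF *(2)]
  show "smooth_fun_on M \<A> U' (\<lambda>p. chart_tvec M \<A> (D, \<phi>) p e f)"
  proof (rule smooth_fun_onI[OF U'])
    fix E \<psi> k assume E: "(E, \<psi>) \<in> \<A>"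
    let ?F = "f \<circ> inv_into D \<phi>" and ?h = "\<phi> \<circ> inv_into E \<psi>" and ?S = "\<psi> ` (E \<inter> U')"
    have S: "open ?S" by (rule open_chart_image[OF E U'])
    \<comment> \<open>Smoothness is tested in every chart \<open>E\<close>, while the derivative is
      taken in \<open>D\<close>. In the coordinates of \<open>E\<close> it becomes a partial
      derivative in \<open>D\<close> coordinates composed with the transition map.\<close>
    have "Ck_on k (\<phi> ` (D \<inter> U')) (\<lambda>x. frechet_derivative ?F (at x) e)"
      by (rule Ck_on_frechet_derivative(2)[OF open_chart_image[OF D U'] smooth_fun_onD[OF *(2) D]])
    moreover have "Ck_on k ?S ?h"
      by (rule Ck_on_subset[OF chart_transition[OF E D]]) (use * in auto)
    moreover have "?h ` ?S \<subseteq> \<phi> ` (D \<inter> U')" using E * by auto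
    ultimately have "Ck_on k ?S (\<lambda>x. frechet_derivative ?F (at (?h x)) e)"
      by (rule Ck_on_compose)
    then show "Ck_on k ?S (\<lambda>x. chart_tvec M \<A> (D, \<phi>) (inv_into E \<psi> x) e f)"
    proof (rule Ck_on_cong[OF S])
      fix x assume "x \<in> ?S"
      then obtain q where q: "x = \<psi> q" "q \<in> E" "q \<in> U'" by auto
      have "smooth_fun_near M \<A> q f" by (rule smooth_fun_nearI[OF *(2) q(3)])
      then show "frechet_derivative ?F (at (?h x)) e = chart_tvec M \<A> (D, \<phi>) (inv_into E \<psi> x) e f"
        using q E by (simp add: chart_tvec_apply)
    qed
  qed
qed

end


section \<open>The trace in a two-dimensional space\<close>

text \<open>Cyclicity of the trace: on \<open>S\<close> the identity factors through the plane as v,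
  (\<alpha> v, \<beta> v), \<alpha> v t + \<beta> v n, so the trace of \<open>L\<close> is that of a
  2 by 2 matrix with diagonal \<alpha>(L t), \<beta>(L n). In a basis \<open>B\<close> this amounts
  to moving \<open>\<alpha>\<close> and \<open>\<beta>\<close> out of the sum over
  \<open>B\<close>.\<close>

lemma trace_on_pair:
  fixes S :: "'v::real_vector set" and \<alpha> \<beta> :: "'v \<Rightarrow> real"
  assumes S: "subspace S" and tn: "t \<in> S" "n \<in> S"
    and rep: "\<And>v. v \<in> S \<Longrightarrow> v = \<alpha> v *\<^sub>R t + \<beta> v *\<^sub>R n"
    and \<alpha>: "\<And>u v. u \<in> S \<Longrightarrow> v \<in> S \<Longrightarrow> \<alpha> (u + v) = \<alpha> u + \<alpha> v" "\<And>c v. v \<in> S \<Longrightarrow> \<alpha> (c *\<^sub>R v) = c * \<alpha> v"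
    and \<beta>: "\<And>u v. u \<in> S \<Longrightarrow> v \<in> S \<Longrightarrow> \<beta> (u + v) = \<beta> u + \<beta> v" "\<And>c v. v \<in> S \<Longrightarrow> \<beta> (c *\<^sub>R v) = c * \<beta> v"
    and L: "\<And>v. v \<in> S \<Longrightarrow> L v \<in> S"
      "\<And>u v. u \<in> S \<Longrightarrow> v \<in> S \<Longrightarrow> L (u + v) = L u + L v" "\<And>c v. v \<in> S \<Longrightarrow> L (c *\<^sub>R v) = c *\<^sub>R L v"
  shows "trace_on S L = \<alpha> (L t) + \<beta> (L n)"
proof -
  have lin_sum: "\<gamma> (\<Sum>b\<in>B. c b *\<^sub>R b) = (\<Sum>b\<in>B. c b * \<gamma> b)"
    if "finite B" "B \<subseteq> S" and \<gamma>: "\<And>u v. u \<in> S \<Longrightarrow> v \<in> S \<Longrightarrow> \<gamma> (u + v) = \<gamma> u + \<gamma> v"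
      "\<And>c v. v \<in> S \<Longrightarrow> \<gamma> (c *\<^sub>R v) = c * \<gamma> v" for B c and \<gamma> :: "'v \<Rightarrow> real"
    using that(1,2)
  proof (induction B rule: finite_induct)
    case empty
    show ?case using \<gamma>(2)[OF tn(1), of 0] by simp
  next
    case (insert b B)
    have "(\<Sum>b\<in>B. c b *\<^sub>R b) \<in> S" using insert S by (intro subspace_sum subspace_scale) auto
    moreover have "c b *\<^sub>R b \<in> S" using insert S subspace_scale by auto
    ultimately show ?case using insert \<gamma> by simp
  qed
  have trace: "(\<Sum>b\<in>B. representation B (L b) b) = \<alpha> (L t) + \<beta> (L n)"
    if B: "finite B" "independent B" "span B = S" for B
  proof -
    have BS: "B \<subseteq> S" using B(3) span_superset by blast
    have "representation B (L b) b
        = representation B (L t) b * \<alpha> b + representation B (L n) b * \<beta> b" if "b \<in> B" for b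
    proof -
      have bS: "b \<in> S" using that BS by auto
      have "L b = L (\<alpha> b *\<^sub>R t + \<beta> b *\<^sub>R n)" using rep[OF bS] by simp
      also have "\<dots> = \<alpha> b *\<^sub>R L t + \<beta> b *\<^sub>R L n"
        using L(2,3) tn subspace_scale[OF S] by simp
      finally have Lb: "L b = \<alpha> b *\<^sub>R L t + \<beta> b *\<^sub>R L n" .
      have "L t \<in> span B" "L n \<in> span B" using B(3) tn L(1) by auto
      then show ?thesis unfolding Lb
        by (simp add: representation_add[OF B(2)] representation_scale[OF B(2)] span_scale)
    qed
    then have "(\<Sum>b\<in>B. representation B (L b) b)
        = (\<Sum>b\<in>B. representation B (L t) b * \<alpha> b) + (\<Sum>b\<in>B. representation B (L n) b * \<beta> b)"
      by (simp add: sum.distrib)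
    also have "\<dots> = \<alpha> (\<Sum>b\<in>B. representation B (L t) b *\<^sub>R b) + \<beta> (\<Sum>b\<in>B. representation B (L n) b *\<^sub>R b)"
      by (simp add: lin_sum[OF B(1) BS \<alpha>] lin_sum[OF B(1) BS \<beta>])
    also have "\<dots> = \<alpha> (L t) + \<beta> (L n)"
      using sum_representation_eq[OF B(2) _ B(1) subset_refl] tn L(1) B(3) by simp
    finally show ?thesis .
  qed
  \<comment> \<open>Uniqueness in the definite description requires at least one finite basis;
    without one the defining condition would be vacuous.\<close>
  obtain B where B: "B \<subseteq> {t, n}" "independent B" "{t, n} \<subseteq> span B"
    using maximal_independent_subset[of "{t, n}"] by blast
  have fin: "finite B" using B(1) by (rule finite_subset) simp
  have span: "span B = S"
  proof
    show "span B \<subseteq> S" using B(1) tn S by (intro span_minimal) auto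
    show "S \<subseteq> span B"
    proof
      fix v assume "v \<in> S"
      then have v: "v = \<alpha> v *\<^sub>R t + \<beta> v *\<^sub>R n" by (rule rep)
      have "\<alpha> v *\<^sub>R t + \<beta> v *\<^sub>R n \<in> span B"
        using B(3) by (intro span_add span_scale) auto
      then show "v \<in> span B" by (subst v)
    qed
  qed
  show ?thesis unfolding trace_on_def
  proof (rule the_equality)
    show "\<forall>B. finite B \<and> independent B \<and> span B = S \<longrightarrow>
        \<alpha> (L t) + \<beta> (L n) = (\<Sum>b\<in>B. representation B (L b) b)"
      by (simp add: trace)
    fix s assume "\<forall>B. finite B \<and> independent B \<and> span B = S \<longrightarrow> s = (\<Sum>b\<in>B. representation B (L b) b)"
    with fin B(2) span have "s = (\<Sum>b\<in>B. representation B (L b) b)" by blast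
    also note trace[OF fin B(2) span]
    finally show "s = \<alpha> (L t) + \<beta> (L n)" .
  qed
qed


section \<open>Riemannian surfaces\<close>

locale riemannian_surface = smooth_atlas M \<A>
  for M :: "'m topology" and \<A> :: "('m, real^2) chart set" +
  fixes g :: "'m \<Rightarrow> 'm tvec \<Rightarrow> 'm tvec \<Rightarrow> real" and nab :: "'m connection"
  assumes metric: "riemannian_metric M \<A> g"
    and levi_civita: "levi_civita_connection M \<A> g nab"
begin

abbreviation "TS \<equiv> tangent_space M \<A>"

lemma metric_algebra:
  assumes "p \<in> topspace M" "u \<in> TS p" "v \<in> TS p"
  shows g_sym: "g p u v = g p v u"
    and g_add_left: "\<And>w. w \<in> TS p \<Longrightarrow> g p (u + v) w = g p u w + g p v w"
    and g_scale_left: "\<And>c. g p (c *\<^sub>R u) v = c * g p u v"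
proof -
  note * = metric[unfolded riemannian_metric_def, THEN conjunct1, THEN bspec, THEN bspec, THEN bspec,
      OF assms]
  from * show "g p u v = g p v u" "\<And>w. w \<in> TS p \<Longrightarrow> g p (u + v) w = g p u w + g p v w"
    "\<And>c. g p (c *\<^sub>R u) v = c * g p u v" by blast+
qed

lemma g_pos: "p \<in> topspace M \<Longrightarrow> v \<in> TS p \<Longrightarrow> v \<noteq> 0 \<Longrightarrow> g p v v > 0"
  using metric[unfolded riemannian_metric_def, THEN conjunct2, THEN conjunct1] by simp

lemma smooth_fun_on_metric:
  "smooth_field_on M \<A> U V \<Longrightarrow> smooth_field_on M \<A> U W \<Longrightarrow> smooth_fun_on M \<A> U (\<lambda>p. g p (V p) (W p))"
  using metric[unfolded riemannian_metric_def, THEN conjunct2, THEN conjunct2] by simp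

lemma TS_add: "p \<in> topspace M \<Longrightarrow> u \<in> TS p \<Longrightarrow> v \<in> TS p \<Longrightarrow> u + v \<in> TS p"
  using subspace_add subspace_tangent_space by blast

lemma TS_scale: "p \<in> topspace M \<Longrightarrow> u \<in> TS p \<Longrightarrow> c *\<^sub>R u \<in> TS p"
  using subspace_scale subspace_tangent_space by blast

lemma TS_diff: "p \<in> topspace M \<Longrightarrow> u \<in> TS p \<Longrightarrow> v \<in> TS p \<Longrightarrow> u - v \<in> TS p"
  using subspace_diff subspace_tangent_space by blast

lemma g_add_right:
  "p \<in> topspace M \<Longrightarrow> u \<in> TS p \<Longrightarrow> v \<in> TS p \<Longrightarrow> w \<in> TS p \<Longrightarrow> g p w (u + v) = g p w u + g p w v"
  using g_sym[of p w] TS_add g_add_left by metis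

lemma g_scale_right:
  "p \<in> topspace M \<Longrightarrow> u \<in> TS p \<Longrightarrow> v \<in> TS p \<Longrightarrow> g p v (c *\<^sub>R u) = c * g p v u"
  using g_sym[of p v] TS_scale g_scale_left by metis

lemma g_diff_left:
  assumes "p \<in> topspace M" "u \<in> TS p" "v \<in> TS p" "w \<in> TS p"
  shows "g p (u - v) w = g p u w - g p v w"
  using g_add_left[OF assms(1) TS_diff[OF assms(1-3)] assms(3,4)] by simp

lemma g_zero: "p \<in> topspace M \<Longrightarrow> v \<in> TS p \<Longrightarrow> g p 0 v = 0"
  using g_scale_left[of p v v 0] by simp

lemmas g_simps = g_add_left g_scale_left g_add_right g_scale_right g_diff_left TS_add TS_scale TS_diff

lemma affine: "affine_connection M \<A> nab"
  using levi_civita unfolding levi_civita_connection_def by blast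

lemma smooth_field_on_nab:
  "smooth_field_on M \<A> U V \<Longrightarrow> smooth_field_on M \<A> U W \<Longrightarrow> smooth_field_on M \<A> U (\<lambda>p. nab p (V p) W)"
  using affine[unfolded affine_connection_def, THEN conjunct1] by simp

lemma nab_dir:
  assumes "p \<in> topspace M" "smooth_field_near M \<A> p W" "v \<in> TS p"
  shows nab_mem: "nab p v W \<in> TS p"
    and nab_add_dir: "\<And>u. u \<in> TS p \<Longrightarrow> nab p (u + v) W = nab p u W + nab p v W"
    and nab_scale_dir: "\<And>c. nab p (c *\<^sub>R v) W = c *\<^sub>R nab p v W"
proof -
  have "\<forall>p\<in>topspace M. \<forall>W. smooth_field_near M \<A> p W \<longrightarrow>
        (\<forall>v\<in>TS p. nab p v W \<in> TS p) \<and>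
        (\<forall>u\<in>TS p. \<forall>v\<in>TS p. nab p (u + v) W = nab p u W + nab p v W) \<and>
        (\<forall>v\<in>TS p. \<forall>c. nab p (c *\<^sub>R v) W = c *\<^sub>R nab p v W)"
    using affine unfolding affine_connection_def by (elim conjE)
  from this[rule_format, OF assms(1,2)] assms(3)
  show "nab p v W \<in> TS p" "\<And>u. u \<in> TS p \<Longrightarrow> nab p (u + v) W = nab p u W + nab p v W"
    "\<And>c. nab p (c *\<^sub>R v) W = c *\<^sub>R nab p v W" by simp_all
qed

lemma nab_field:
  assumes "p \<in> topspace M" "v \<in> TS p" "smooth_field_near M \<A> p W"
  shows nab_add: "\<And>Z. smooth_field_near M \<A> p Z \<Longrightarrow> nab p v (\<lambda>q. W q + Z q) = nab p v W + nab p v Z"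
    and nab_Leibniz: "\<And>f. smooth_fun_near M \<A> p f \<Longrightarrow>
      nab p v (\<lambda>q. f q *\<^sub>R W q) = v f *\<^sub>R W p + f p *\<^sub>R nab p v W"
    and nab_local: "\<And>Z U. openin M U \<Longrightarrow> p \<in> U \<Longrightarrow> (\<And>q. q \<in> U \<Longrightarrow> W q = Z q) \<Longrightarrow> nab p v W = nab p v Z"
proof -
  have *: "(\<forall>W Z. smooth_field_near M \<A> p W \<and> smooth_field_near M \<A> p Z \<longrightarrow>
           nab p v (\<lambda>q. W q + Z q) = nab p v W + nab p v Z) \<and>
        (\<forall>W f. smooth_field_near M \<A> p W \<and> smooth_fun_near M \<A> p f \<longrightarrow>
           nab p v (\<lambda>q. f q *\<^sub>R W q) = v f *\<^sub>R W p + f p *\<^sub>R nab p v W) \<and>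
        (\<forall>W Z U. smooth_field_near M \<A> p W \<and> openin M U \<and> p \<in> U \<and> (\<forall>q\<in>U. W q = Z q) \<longrightarrow>
           nab p v W = nab p v Z)"
    using affine[unfolded affine_connection_def, THEN conjunct2, THEN conjunct2,
        THEN bspec, THEN bspec, OF assms(1,2)] .
  show "\<And>Z. smooth_field_near M \<A> p Z \<Longrightarrow> nab p v (\<lambda>q. W q + Z q) = nab p v W + nab p v Z"
    using *[THEN conjunct1] assms(3) by blast
  show "\<And>f. smooth_fun_near M \<A> p f \<Longrightarrow> nab p v (\<lambda>q. f q *\<^sub>R W q) = v f *\<^sub>R W p + f p *\<^sub>R nab p v W"
    using *[THEN conjunct2, THEN conjunct1] assms(3) by blast
  show "\<And>Z U. openin M U \<Longrightarrow> p \<in> U \<Longrightarrow> (\<And>q. q \<in> U \<Longrightarrow> W q = Z q) \<Longrightarrow> nab p v W = nab p v Z"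
    using *[THEN conjunct2, THEN conjunct2] assms(3) by blast
qed

lemma nab_torsion:
  "p \<in> topspace M \<Longrightarrow> smooth_field_near M \<A> p V \<Longrightarrow> smooth_field_near M \<A> p W \<Longrightarrow>
    lie_bracket M \<A> V W p = nab p (V p) W - nab p (W p) V"
  using levi_civita unfolding levi_civita_connection_def torsion_free_def by simp

lemma nab_metric:
  "p \<in> topspace M \<Longrightarrow> v \<in> TS p \<Longrightarrow> smooth_field_near M \<A> p W \<Longrightarrow> smooth_field_near M \<A> p Z \<Longrightarrow>
    v (\<lambda>q. g q (W q) (Z q)) = g p (nab p v W) (Z p) + g p (W p) (nab p v Z)"
  using levi_civita unfolding levi_civita_connection_def metric_compatible_def by simp

end


section \<open>Orthonormal frames\<close>

locale orthonormal_frame = riemannian_surface M \<A> g nab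
  for M :: "'m topology" and \<A> :: "('m, real^2) chart set" and g nab +
  fixes U :: "'m set" and T N :: "'m \<Rightarrow> 'm tvec"
  assumes T: "smooth_field_on M \<A> U T" and N: "smooth_field_on M \<A> U N"
    and unit_T: "q \<in> U \<Longrightarrow> g q (T q) (T q) = 1"
    and unit_N: "q \<in> U \<Longrightarrow> g q (N q) (N q) = 1"
    and orthogonal: "q \<in> U \<Longrightarrow> g q (T q) (N q) = 0"
begin

lemma U: "openin M U"
  by (rule smooth_field_on_openin[OF T])

lemma U_topspace: "q \<in> U \<Longrightarrow> q \<in> topspace M"
  using openin_subset[OF U] by blast

lemmas T_mem = smooth_field_onD(1)[OF T] and N_mem = smooth_field_onD(1)[OF N]

lemma orthogonal': "q \<in> U \<Longrightarrow> g q (N q) (T q) = 0"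
  using orthogonal g_sym[OF U_topspace T_mem N_mem] by simp

lemmas frame_simps = U_topspace T_mem N_mem unit_T unit_N orthogonal orthogonal' g_simps

lemma g_comb:
  assumes "q \<in> U"
  shows "g q (\<alpha> *\<^sub>R T q + \<beta> *\<^sub>R N q) (T q) = \<alpha>" "g q (\<alpha> *\<^sub>R T q + \<beta> *\<^sub>R N q) (N q) = \<beta>"
  using assms by (simp_all add: frame_simps)

text \<open>Dimension two enters here: orthonormality makes the coordinate vectors \<open>t\<close>,
  \<open>n\<close> of the frame independent in the plane, so their determinant \<open>?d\<close> is
  nonzero and every vector is a combination of them.\<close>

lemma frame_spans:
  assumes q: "q \<in> U" and v: "v \<in> TS q"
  shows "\<exists>\<alpha> \<beta>. v = \<alpha> *\<^sub>R T q + \<beta> *\<^sub>R N q"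
proof -
  obtain D \<phi> where D: "(D, \<phi>) \<in> \<A>" "q \<in> D" using chart_at[OF U_topspace[OF q]] by blast
  let ?L = "chart_tvec M \<A> (D, \<phi>) q"
  have lin: "linear ?L" by (rule linear_chart_tvec[OF D])
  have "v \<in> range ?L" "T q \<in> range ?L" "N q \<in> range ?L"
    using v T_mem[OF q] N_mem[OF q] tangent_space_eq_range[OF D] by auto
  then obtain w t n where w: "v = ?L w" and t: "T q = ?L t" and n: "N q = ?L n" by blast
  have comb: "\<alpha> *\<^sub>R T q + \<beta> *\<^sub>R N q = ?L (\<alpha> *\<^sub>R t + \<beta> *\<^sub>R n)" for \<alpha> \<beta>
    by (simp add: t n linear_add[OF lin] linear_cmul[OF lin])
  have indep: "\<alpha> = 0 \<and> \<beta> = 0" if "\<alpha> *\<^sub>R t + \<beta> *\<^sub>R n = 0" for \<alpha> \<beta>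
  proof -
    have "\<alpha> *\<^sub>R T q + \<beta> *\<^sub>R N q = 0" unfolding comb that by (rule linear_0[OF lin])
    then show ?thesis
      using g_comb[OF q, of \<alpha> \<beta>] g_zero[OF U_topspace T_mem, OF q q]
        g_zero[OF U_topspace N_mem, OF q q] by presburger
  qed
  let ?d = "t $ 1 * n $ 2 - t $ 2 * n $ 1"
  have "?d \<noteq> 0"
  proof
    assume d: "?d = 0"
    \<comment> \<open>If the determinant vanishes, these are linear relations between
      \<open>t\<close> and \<open>n\<close>; independence then forces every entry of
      \<open>t\<close> to be 0, and t = 0 is itself a forbidden relation.\<close>
    have "n $ 2 *\<^sub>R t + (- t $ 2) *\<^sub>R n = 0" "n $ 1 *\<^sub>R t + (- t $ 1) *\<^sub>R n = 0"
      using d by (auto simp: vec_eq_iff forall_2 algebra_simps)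
    from indep[OF this(1)] indep[OF this(2)] have "1 *\<^sub>R t + 0 *\<^sub>R n = 0"
      by (auto simp: vec_eq_iff forall_2)
    from indep[OF this] show False by simp
  qed
  \<comment> \<open>Cramer's rule, with the denominators cleared.\<close>
  have "?d *\<^sub>R w = (w $ 1 * n $ 2 - w $ 2 * n $ 1) *\<^sub>R t + (t $ 1 * w $ 2 - t $ 2 * w $ 1) *\<^sub>R n"
    by (auto simp: vec_eq_iff forall_2 algebra_simps)
  then have "(1 / ?d) *\<^sub>R (?d *\<^sub>R w) = ((w $ 1 * n $ 2 - w $ 2 * n $ 1) / ?d) *\<^sub>R t
      + ((t $ 1 * w $ 2 - t $ 2 * w $ 1) / ?d) *\<^sub>R n"
    by (simp add: scaleR_add_right)
  then have "w = ((w $ 1 * n $ 2 - w $ 2 * n $ 1) / ?d) *\<^sub>R t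
      + ((t $ 1 * w $ 2 - t $ 2 * w $ 1) / ?d) *\<^sub>R n"
    using \<open>?d \<noteq> 0\<close> by simp
  then show ?thesis using w comb by metis
qed

lemma frame_decomp:
  assumes "q \<in> U" "v \<in> TS q"
  shows "v = g q v (T q) *\<^sub>R T q + g q v (N q) *\<^sub>R N q"
proof -
  obtain \<alpha> \<beta> where v: "v = \<alpha> *\<^sub>R T q + \<beta> *\<^sub>R N q" using frame_spans[OF assms] by blast
  show ?thesis unfolding g_comb[OF assms(1), of \<alpha> \<beta>, folded v] by (rule v)
qed

lemma trace_on_TS:
  assumes "q \<in> U" "\<And>v. v \<in> TS q \<Longrightarrow> L v \<in> TS q"
    "\<And>u v. u \<in> TS q \<Longrightarrow> v \<in> TS q \<Longrightarrow> L (u + v) = L u + L v"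
    "\<And>c v. v \<in> TS q \<Longrightarrow> L (c *\<^sub>R v) = c *\<^sub>R L v"
  shows "trace_on (TS q) L = g q (L (T q)) (T q) + g q (L (N q)) (N q)"
proof (rule trace_on_pair[OF subspace_tangent_space])
  note mem = U_topspace[OF assms(1)] T_mem[OF assms(1)] N_mem[OF assms(1)]
  show "q \<in> topspace M" "T q \<in> TS q" "N q \<in> TS q" by (rule mem)+
  fix u v c assume *: "v \<in> TS q"
  show "v = g q v (T q) *\<^sub>R T q + g q v (N q) *\<^sub>R N q" by (rule frame_decomp[OF assms(1) *])
  show "g q (c *\<^sub>R v) (T q) = c * g q v (T q)" "g q (c *\<^sub>R v) (N q) = c * g q v (N q)"
    by (rule g_scale_left[OF mem(1) * mem(2)] g_scale_left[OF mem(1) * mem(3)])+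
  assume "u \<in> TS q"
  then show "g q (u + v) (T q) = g q u (T q) + g q v (T q)"
    "g q (u + v) (N q) = g q u (N q) + g q v (N q)"
    by (rule g_add_left[OF mem(1) _ * mem(2)] g_add_left[OF mem(1) _ * mem(3)])+
qed (fact assms(2-4))+

lemma divergence_frame:
  assumes q: "q \<in> U" and V: "smooth_field_near M \<A> q V"
  shows "divergence M \<A> nab V q = g q (nab q (T q) V) (T q) + g q (nab q (N q) V) (N q)"
  unfolding divergence_def
  by (rule trace_on_TS[OF q])
    (simp_all add: nab_mem nab_add_dir nab_scale_dir U_topspace[OF q] V)

lemma fields_near:
  assumes "q \<in> U"
  shows "smooth_field_near M \<A> q T" "smooth_field_near M \<A> q N"
  using smooth_field_nearI[OF T assms] smooth_field_nearI[OF N assms] by auto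

definition \<omega> :: "'m \<Rightarrow> 'm tvec \<Rightarrow> real" where
  "\<omega> q v = g q (nab q v T) (N q)"

text \<open>Differentiating g(T, T) = 1 with the metric connection leaves no component along
  \<open>T\<close>.\<close>

lemma nab_T:
  assumes q: "q \<in> U" and v: "v \<in> TS q"
  shows "nab q v T = \<omega> q v *\<^sub>R N q"
proof -
  note near = fields_near[OF q] and top = U_topspace[OF q]
  have mem: "nab q v T \<in> TS q" by (rule nab_mem[OF top near(1) v])
  have "v (\<lambda>q. g q (T q) (T q)) = v (\<lambda>q. 1)"
    by (rule tangent_local[OF v smooth_fun_on_metric[OF T T] q unit_T])
  then have "g q (nab q v T) (T q) = 0"
    using nab_metric[OF top v near(1,1)] tangent_const[OF v, of 1]
      g_sym[OF top mem T_mem[OF q]] by simp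
  with frame_decomp[OF q mem] show ?thesis by (simp add: \<omega>_def)
qed

text \<open>Differentiating g(N, N) = 1 removes the component along \<open>N\<close>;
  differentiating g(T, N) = 0 identifies the one along \<open>T\<close> as the negative of
  \<open>\<omega>\<close>.\<close>

lemma nab_N:
  assumes q: "q \<in> U" and v: "v \<in> TS q"
  shows "nab q v N = (- \<omega> q v) *\<^sub>R T q"
proof -
  note near = fields_near[OF q] and top = U_topspace[OF q]
  have mem: "nab q v N \<in> TS q" "nab q v T \<in> TS q" by (rule nab_mem[OF top near(2) v] nab_mem[OF top near(1) v])+
  have "v (\<lambda>q. g q (N q) (N q)) = v (\<lambda>q. 1)"
    by (rule tangent_local[OF v smooth_fun_on_metric[OF N N] q unit_N])
  then have 1: "g q (nab q v N) (N q) = 0"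
    using nab_metric[OF top v near(2,2)] tangent_const[OF v, of 1]
      g_sym[OF top mem(1) N_mem[OF q]] by simp
  have "v (\<lambda>q. g q (T q) (N q)) = v (\<lambda>q. 0)"
    by (rule tangent_local[OF v smooth_fun_on_metric[OF T N] q orthogonal])
  then have "g q (nab q v N) (T q) = - \<omega> q v"
    using nab_metric[OF top v near(1,2)] tangent_const[OF v, of 0]
      g_sym[OF top mem(1) T_mem[OF q]] by (simp add: \<omega>_def)
  with 1 frame_decomp[OF q mem(1)] show ?thesis by simp
qed

lemma \<omega>_comb:
  assumes q: "q \<in> U" and v: "v \<in> TS q"
  shows "\<omega> q v = g q v (T q) * \<omega> q (T q) + g q v (N q) * \<omega> q (N q)"
proof -
  note near = fields_near[OF q] and top = U_topspace[OF q] and mem = T_mem[OF q] N_mem[OF q]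
  have "nab q v T = nab q (g q v (T q) *\<^sub>R T q + g q v (N q) *\<^sub>R N q) T"
    using frame_decomp[OF q v] by simp
  also have "\<dots> = g q v (T q) *\<^sub>R nab q (T q) T + g q v (N q) *\<^sub>R nab q (N q) T"
    by (simp add: nab_add_dir nab_scale_dir top near mem TS_scale)
  finally show ?thesis
    using nab_mem[OF top near(1)] mem top by (simp add: \<omega>_def g_simps)
qed

text \<open>Leibniz rule in a moving frame: the pair (c, d) is differentiated along
  \<open>v\<close>, and the turning of the frame adds \<omega>(v) times the pair rotated by a right
  angle.\<close>

lemma nab_comb:
  assumes q: "q \<in> U" and v: "v \<in> TS q"
    and c: "smooth_fun_on M \<A> U c" and d: "smooth_fun_on M \<A> U d"
  shows "nab q v (\<lambda>q. c q *\<^sub>R T q + d q *\<^sub>R N q)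
    = (v c - d q * \<omega> q v) *\<^sub>R T q + (v d + c q * \<omega> q v) *\<^sub>R N q"
proof -
  have rotate: "x *\<^sub>R t + c *\<^sub>R (w *\<^sub>R n) + (y *\<^sub>R n + d *\<^sub>R ((- w) *\<^sub>R t))
      = (x - d * w) *\<^sub>R t + (y + c * w) *\<^sub>R n" for x y c d w and t n :: "'v::real_vector"
    by (simp add: algebra_simps)
  note near = fields_near[OF q] and top = U_topspace[OF q]
  have "nab q v (\<lambda>q. c q *\<^sub>R T q + d q *\<^sub>R N q)
      = nab q v (\<lambda>q. c q *\<^sub>R T q) + nab q v (\<lambda>q. d q *\<^sub>R N q)"
    by (intro nab_add[OF top v] smooth_field_nearI[OF smooth_field_on_scale q] T N c d)
  also have "nab q v (\<lambda>q. c q *\<^sub>R T q) = v c *\<^sub>R T q + c q *\<^sub>R nab q v T"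
    by (rule nab_Leibniz[OF top v near(1) smooth_fun_nearI[OF c q]])
  also have "nab q v (\<lambda>q. d q *\<^sub>R N q) = v d *\<^sub>R N q + d q *\<^sub>R nab q v N"
    by (rule nab_Leibniz[OF top v near(2) smooth_fun_nearI[OF d q]])
  finally show ?thesis unfolding nab_T[OF q v] nab_N[OF q v] by (simp only: rotate)
qed

lemma smooth_comb:
  assumes "smooth_fun_on M \<A> U c" "smooth_fun_on M \<A> U d"
  shows "smooth_field_on M \<A> U (\<lambda>q. c q *\<^sub>R T q + d q *\<^sub>R N q)"
  by (intro smooth_field_on_add smooth_field_on_scale T N assms)

text \<open>Version for fields whose components are known on \<open>U\<close> only, by locality of
  the connection. It serves for iterated covariant derivatives and for \<open>Y\<close>.\<close>

lemma nab_eq_comb: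
  assumes q: "q \<in> U" and v: "v \<in> TS q"
    and c: "smooth_fun_on M \<A> U c" and d: "smooth_fun_on M \<A> U d"
    and W: "\<And>q. q \<in> U \<Longrightarrow> W q = c q *\<^sub>R T q + d q *\<^sub>R N q"
  shows "nab q v W = (v c - d q * \<omega> q v) *\<^sub>R T q + (v d + c q * \<omega> q v) *\<^sub>R N q"
  unfolding nab_comb[OF q v c d, symmetric]
  by (rule nab_local[symmetric, OF U_topspace[OF q] v smooth_field_nearI[OF smooth_comb[OF c d] q] U q])
    (simp add: W)

lemma smooth_coeff:
  assumes "smooth_field_on M \<A> U W"
  shows "smooth_fun_on M \<A> U (\<lambda>q. g q (W q) (T q))" "smooth_fun_on M \<A> U (\<lambda>q. g q (W q) (N q))"
  by (intro smooth_fun_on_metric assms T N)+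

lemma nab_smooth_field:
  assumes q: "q \<in> U" and v: "v \<in> TS q" and W: "smooth_field_on M \<A> U W"
  shows "nab q v W = (v (\<lambda>q. g q (W q) (T q)) - g q (W q) (N q) * \<omega> q v) *\<^sub>R T q
      + (v (\<lambda>q. g q (W q) (N q)) + g q (W q) (T q) * \<omega> q v) *\<^sub>R N q"
  by (rule nab_eq_comb[OF q v smooth_coeff[OF W]])
    (rule frame_decomp[OF _ smooth_field_onD(1)[OF W]])

lemma smooth_\<omega>: "smooth_field_on M \<A> U V \<Longrightarrow> smooth_fun_on M \<A> U (\<lambda>q. \<omega> q (V q))"
  unfolding \<omega>_def by (intro smooth_fun_on_metric smooth_field_on_nab T N)

end


section \<open>Curvature in an orthonormal frame\<close>

context orthonormal_frame
begin

text \<open>This is - d\<omega>(T, N). Torsion-freeness gives [T, N] = - \<omega>(T) T - \<omega>(N)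
  N, and the two squares are the contribution of \<omega>([T, N]).\<close>

definition \<kappa> :: "'m \<Rightarrow> real" where
  "\<kappa> q = N q (\<lambda>r. \<omega> r (T r)) - T q (\<lambda>r. \<omega> r (N r)) - (\<omega> q (T q))\<^sup>2 - (\<omega> q (N q))\<^sup>2"

lemma tangent_frame:
  assumes "q \<in> U" "v \<in> TS q"
  shows "v f = g q v (T q) * T q f + g q v (N q) * N q f"
proof -
  have "v f = (g q v (T q) *\<^sub>R T q + g q v (N q) *\<^sub>R N q) f"
    using arg_cong[OF frame_decomp[OF assms], of "\<lambda>w. w f"] .
  then show ?thesis by (simp add: scaleR_fun_def)
qed

text \<open>Expands \<omega>(B) in the frame and applies the product rule, so that derivatives of
  \<open>\<omega>\<close> along arbitrary fields reduce to those of \<omega>(T) and \<omega>(N), the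
  functions that occur in \<open>\<kappa>\<close>.\<close>

lemma tangent_\<omega>:
  assumes q: "q \<in> U" and v: "v \<in> TS q" and B: "smooth_field_on M \<A> U B"
  shows "v (\<lambda>r. \<omega> r (B r)) =
    v (\<lambda>r. g r (B r) (T r)) * \<omega> q (T q) + g q (B q) (T q) * v (\<lambda>r. \<omega> r (T r)) +
    (v (\<lambda>r. g r (B r) (N r)) * \<omega> q (N q) + g q (B q) (N q) * v (\<lambda>r. \<omega> r (N r)))"
proof -
  note sm = smooth_coeff[OF B] smooth_\<omega>[OF T] smooth_\<omega>[OF N]
  note near = sm[THEN smooth_fun_nearI, OF q]
  have "v (\<lambda>r. \<omega> r (B r)) = v (\<lambda>r. g r (B r) (T r) * \<omega> r (T r) + g r (B r) (N r) * \<omega> r (N r))"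
    by (rule tangent_local[OF v smooth_\<omega>[OF B] q]) (rule \<omega>_comb[OF _ smooth_field_onD(1)[OF B]])
  also have "\<dots> = v (\<lambda>r. g r (B r) (T r) * \<omega> r (T r)) + v (\<lambda>r. g r (B r) (N r) * \<omega> r (N r))"
    by (rule tangent_add[OF v smooth_fun_near_mult[OF near(1,3)] smooth_fun_near_mult[OF near(2,4)]])
  finally show ?thesis unfolding tangent_mult[OF v near(1,3)] tangent_mult[OF v near(2,4)] .
qed

text \<open>Obtained from torsion-freeness instead of the commutator. This shows at once that the
  bracket is a tangent vector, and it expresses the components through
  \<open>\<omega>\<close>.\<close>

lemma lie_bracket_frame:
  assumes q: "q \<in> U" and A: "smooth_field_on M \<A> U A" and B: "smooth_field_on M \<A> U B"
  shows "lie_bracket M \<A> A B q \<in> TS q"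
    and "g q (lie_bracket M \<A> A B q) (T q) =
      A q (\<lambda>r. g r (B r) (T r)) - g q (B q) (N q) * \<omega> q (A q) -
      (B q (\<lambda>r. g r (A r) (T r)) - g q (A q) (N q) * \<omega> q (B q))"
    and "g q (lie_bracket M \<A> A B q) (N q) =
      A q (\<lambda>r. g r (B r) (N r)) + g q (B q) (T q) * \<omega> q (A q) -
      (B q (\<lambda>r. g r (A r) (N r)) + g q (A q) (T q) * \<omega> q (B q))"
proof -
  note top = U_topspace[OF q] and nearA = smooth_field_nearI[OF A q] and nearB = smooth_field_nearI[OF B q]
  note memA = smooth_field_onD(1)[OF A q] and memB = smooth_field_onD(1)[OF B q]
  note l = nab_torsion[OF top nearA nearB]
  note mem = nab_mem[OF top nearB memA] nab_mem[OF top nearA memB]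
  show "lie_bracket M \<A> A B q \<in> TS q" unfolding l by (rule TS_diff[OF top mem])
  show "g q (lie_bracket M \<A> A B q) (T q) =
      A q (\<lambda>r. g r (B r) (T r)) - g q (B q) (N q) * \<omega> q (A q) -
      (B q (\<lambda>r. g r (A r) (T r)) - g q (A q) (N q) * \<omega> q (B q))"
    unfolding l g_diff_left[OF top mem T_mem[OF q]]
    unfolding nab_smooth_field[OF q memA B]
      nab_smooth_field[OF q memB A] g_comb[OF q] ..
  show "g q (lie_bracket M \<A> A B q) (N q) =
      A q (\<lambda>r. g r (B r) (N r)) + g q (B q) (T q) * \<omega> q (A q) -
      (B q (\<lambda>r. g r (A r) (N r)) + g q (A q) (T q) * \<omega> q (B q))"
    unfolding l g_diff_left[OF top mem N_mem[OF q]]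
    unfolding nab_smooth_field[OF q memA B]
      nab_smooth_field[OF q memB A] g_comb[OF q] ..
qed

text \<open>The left side is d\<omega>(A, B), the last factor on the right the area form of the
  frame on (A, B). After expansion all derivatives of the coefficients of \<open>A\<close> and
  \<open>B\<close> cancel against those in the bracket, and the rest is antisymmetric in the two
  coefficient pairs.\<close>

lemma d_\<omega>:
  assumes q: "q \<in> U" and A: "smooth_field_on M \<A> U A" and B: "smooth_field_on M \<A> U B"
  shows "A q (\<lambda>r. \<omega> r (B r)) - B q (\<lambda>r. \<omega> r (A r)) - \<omega> q (lie_bracket M \<A> A B q)
    = - \<kappa> q * (g q (A q) (T q) * g q (B q) (N q) - g q (A q) (N q) * g q (B q) (T q))"
proof -
  note memA = smooth_field_onD(1)[OF A q] and memB = smooth_field_onD(1)[OF B q]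
  show ?thesis
    unfolding \<omega>_comb[OF q lie_bracket_frame(1)[OF q A B]] lie_bracket_frame(2,3)[OF q A B]
      tangent_\<omega>[OF q memA B] tangent_\<omega>[OF q memB A]
      \<omega>_comb[OF q memA] \<omega>_comb[OF q memB]
      tangent_frame[OF q memA, of "\<lambda>r. \<omega> r (T r)"] tangent_frame[OF q memA, of "\<lambda>r. \<omega> r (N r)"]
      tangent_frame[OF q memB, of "\<lambda>r. \<omega> r (T r)"] tangent_frame[OF q memB, of "\<lambda>r. \<omega> r (N r)"]
      \<kappa>_def power2_eq_square
    by (simp add: algebra_simps)
qed

lemma nab_nab:
  assumes q: "q \<in> U" and u: "u \<in> TS q" and B: "smooth_field_on M \<A> U B" and W: "smooth_field_on M \<A> U W"
  shows "nab q u (\<lambda>r. nab r (B r) W) =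
    (u (\<lambda>r. B r (\<lambda>s. g s (W s) (T s))) -
      (u (\<lambda>r. g r (W r) (N r)) * \<omega> q (B q) + g q (W q) (N q) * u (\<lambda>r. \<omega> r (B r))) -
      (B q (\<lambda>r. g r (W r) (N r)) + g q (W q) (T q) * \<omega> q (B q)) * \<omega> q u) *\<^sub>R T q +
    (u (\<lambda>r. B r (\<lambda>s. g s (W s) (N s))) +
      (u (\<lambda>r. g r (W r) (T r)) * \<omega> q (B q) + g q (W q) (T q) * u (\<lambda>r. \<omega> r (B r))) +
      (B q (\<lambda>r. g r (W r) (T r)) - g q (W q) (N q) * \<omega> q (B q)) * \<omega> q u) *\<^sub>R N q"
proof -
  \<comment> \<open>\<open>?c\<close> and \<open>?d\<close> are the components of
    \<open>nab r (B r) W\<close> along \<open>T\<close> and \<open>N\<close>. They are smooth on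
    \<open>U\<close>, so the frame formula can be applied a second time.\<close>
  let ?c = "\<lambda>r. B r (\<lambda>s. g s (W s) (T s)) - g r (W r) (N r) * \<omega> r (B r)"
  let ?d = "\<lambda>r. B r (\<lambda>s. g s (W s) (N s)) + g r (W r) (T r) * \<omega> r (B r)"
  note W' = smooth_coeff[OF W]
  note BW = smooth_field_onD(2)[OF B W'(1)] smooth_field_onD(2)[OF B W'(2)]
  note \<omega>B = smooth_\<omega>[OF B]
  note WB = smooth_fun_on_mult[OF W'(1) \<omega>B] smooth_fun_on_mult[OF W'(2) \<omega>B]
  note near = smooth_fun_nearI[OF _ q]
  have c: "u ?c = u (\<lambda>r. B r (\<lambda>s. g s (W s) (T s))) -
      (u (\<lambda>r. g r (W r) (N r)) * \<omega> q (B q) + g q (W q) (N q) * u (\<lambda>r. \<omega> r (B r)))"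
  proof -
    \<comment> \<open>Only the sum and product rules are available for \<open>u\<close>, so a sign
      is treated as multiplication by the constant -1, whose derivative is 0.\<close>
    have m: "u (\<lambda>r. - 1 * (g r (W r) (N r) * \<omega> r (B r))) = - u (\<lambda>r. g r (W r) (N r) * \<omega> r (B r))"
      using tangent_mult[OF u near[OF smooth_fun_on_const[OF U]] near[OF WB(2)], of "-1"]
        tangent_const[OF u, of "-1"] by simp
    have "u ?c = u (\<lambda>r. B r (\<lambda>s. g s (W s) (T s)) + - 1 * (g r (W r) (N r) * \<omega> r (B r)))"
      by simp
    also have "\<dots> = u (\<lambda>r. B r (\<lambda>s. g s (W s) (T s))) + u (\<lambda>r. - 1 * (g r (W r) (N r) * \<omega> r (B r)))"
      by (intro tangent_add[OF u] near BW smooth_fun_on_mult[OF smooth_fun_on_const[OF U] WB(2)])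
    finally show ?thesis unfolding m tangent_mult[OF u near[OF W'(2)] near[OF \<omega>B]] by simp
  qed
  have d: "u ?d = u (\<lambda>r. B r (\<lambda>s. g s (W s) (N s))) +
      (u (\<lambda>r. g r (W r) (T r)) * \<omega> q (B q) + g q (W q) (T q) * u (\<lambda>r. \<omega> r (B r)))"
    unfolding tangent_add[OF u near[OF BW(2)] near[OF WB(1)]]
      tangent_mult[OF u near[OF W'(1)] near[OF \<omega>B]] ..
  have "nab q u (\<lambda>r. nab r (B r) W) = (u ?c - ?d q * \<omega> q u) *\<^sub>R T q + (u ?d + ?c q * \<omega> q u) *\<^sub>R N q"
  proof (rule nab_eq_comb[OF q u])
    show "smooth_fun_on M \<A> U ?c" by (rule smooth_fun_on_diff[OF BW(1) WB(2)])
    show "smooth_fun_on M \<A> U ?d" by (rule smooth_fun_on_add[OF BW(2) WB(1)])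
    show "nab r (B r) W = ?c r *\<^sub>R T r + ?d r *\<^sub>R N r" if "r \<in> U" for r
      by (rule nab_smooth_field[OF that smooth_field_onD(1)[OF B that] W])
  qed
  then show ?thesis unfolding c d .
qed

text \<open>Second derivatives of the components of \<open>W\<close> cancel against the bracket
  term, first derivatives and the products \<omega>(A) \<omega>(B) cancel by symmetry in
  \<open>A\<close> and \<open>B\<close>. What survives is d\<omega>(A, B) times \<open>W\<close>
  rotated by a right angle. Only the values of \<open>A\<close>, \<open>B\<close>, \<open>W\<close>
  at \<open>q\<close> remain on the right.\<close>

lemma curvature_op_frame:
  assumes q: "q \<in> U" and A: "smooth_field_on M \<A> U A" and B: "smooth_field_on M \<A> U B"
    and W: "smooth_field_on M \<A> U W"
  shows "curvature_op M \<A> nab A B W q =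
    (\<kappa> q * (g q (A q) (T q) * g q (B q) (N q) - g q (A q) (N q) * g q (B q) (T q))) *\<^sub>R
      (g q (W q) (N q) *\<^sub>R T q - g q (W q) (T q) *\<^sub>R N q)"
proof -
  note memA = smooth_field_onD(1)[OF A q] and memB = smooth_field_onD(1)[OF B q]
  \<comment> \<open>Here the bracket is used as a commutator, acting on the components of
    \<open>W\<close>; inside \<open>\<omega>\<close> it is used through its frame
    components.\<close>
  have lie: "lie_bracket M \<A> A B q f = A q (\<lambda>r. B r f) - B q (\<lambda>r. A r f)"
    if "smooth_fun_on M \<A> U f" for f
    using smooth_fun_nearI[OF that q] by (simp add: lie_bracket_def)
  have comb: "x *\<^sub>R t + y *\<^sub>R n - (x' *\<^sub>R t + y' *\<^sub>R n) - (x'' *\<^sub>R t + y'' *\<^sub>R n) =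
      z *\<^sub>R (w2 *\<^sub>R t - w1 *\<^sub>R n)"
    if "x - x' - x'' = z * w2" "y - y' - y'' = - z * w1" for x y x' y' x'' y'' z w1 w2 and t n :: "'v::real_vector"
  proof -
    have "x *\<^sub>R t + y *\<^sub>R n - (x' *\<^sub>R t + y' *\<^sub>R n) - (x'' *\<^sub>R t + y'' *\<^sub>R n)
        = (x - x' - x'') *\<^sub>R t + (y - y' - y'') *\<^sub>R n" by (simp add: algebra_simps)
    then show ?thesis unfolding that by (simp add: algebra_simps)
  qed
  have d: "- (A q (\<lambda>r. \<omega> r (B r)) - B q (\<lambda>r. \<omega> r (A r)) - \<omega> q (lie_bracket M \<A> A B q))
    = \<kappa> q * (g q (A q) (T q) * g q (B q) (N q) - g q (A q) (N q) * g q (B q) (T q))"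
    unfolding d_\<omega>[OF q A B] by simp
  show ?thesis
    unfolding curvature_op_def nab_nab[OF q memA B W] nab_nab[OF q memB A W]
      nab_smooth_field[OF q lie_bracket_frame(1)[OF q A B] W] lie[OF smooth_coeff(1)[OF W]]
      lie[OF smooth_coeff(2)[OF W]] d[symmetric]
    by (rule comb) (simp_all add: algebra_simps)
qed

end

section \<open>Riemann tensor, Ricci tensor and Gauss curvature at a point\<close>

context riemannian_surface
begin

lemma orthonormal_frame_subset:
  assumes "orthonormal_frame M \<A> g nab U T N" "openin M R" "R \<subseteq> U"
  shows "orthonormal_frame M \<A> g nab R T N"
proof -
  interpret orthonormal_frame M \<A> g nab U T N by (rule assms(1))
  show ?thesis
    by standard (use assms(3) unit_T unit_N orthogonal smooth_field_on_subset[OF T assms(2,3)]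
        smooth_field_on_subset[OF N assms(2,3)] in auto)
qed

end

context orthonormal_frame
begin

text \<open>The three fields may live on different neighbourhoods of \<open>q\<close>, so the frame
  is restricted to a common one. The domain does not occur in \<open>\<kappa>\<close>, whose value
  therefore stays the same.\<close>

lemma curvature_op_near:
  assumes q: "q \<in> U" and near: "smooth_field_near M \<A> q A" "smooth_field_near M \<A> q B"
    "smooth_field_near M \<A> q W"
  shows "curvature_op M \<A> nab A B W q =
    (\<kappa> q * (g q (A q) (T q) * g q (B q) (N q) - g q (A q) (N q) * g q (B q) (T q))) *\<^sub>R
      (g q (W q) (N q) *\<^sub>R T q - g q (W q) (T q) *\<^sub>R N q)"
proof -
  from near obtain UA UB UW where U': "q \<in> UA" "smooth_field_on M \<A> UA A" "q \<in> UB"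
    "smooth_field_on M \<A> UB B" "q \<in> UW" "smooth_field_on M \<A> UW W"
    unfolding smooth_field_near_def by blast
  let ?R = "U \<inter> (UA \<inter> (UB \<inter> UW))"
  have R: "openin M ?R"
    by (intro openin_Int U U'(2,4,6)[THEN smooth_field_on_openin])
  interpret sub: orthonormal_frame M \<A> g nab ?R T N
    by (rule orthonormal_frame_subset[OF orthonormal_frame_axioms R]) auto
  show ?thesis
    by (rule sub.curvature_op_frame) (use q U' R in \<open>auto intro: smooth_field_on_subset[OF _ R]\<close>)
qed

lemma riemann_tensor_frame:
  assumes q: "q \<in> U" and mem: "u \<in> TS q" "v \<in> TS q" "w \<in> TS q"
  shows "riemann_tensor M \<A> nab q u v w =
    (\<kappa> q * (g q u (T q) * g q v (N q) - g q u (N q) * g q v (T q))) *\<^sub>R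
      (g q w (N q) *\<^sub>R T q - g q w (T q) *\<^sub>R N q)" (is "_ = ?R")
  unfolding riemann_tensor_def
proof (rule the_equality)
  show "\<forall>A B W. smooth_field_near M \<A> q A \<and> smooth_field_near M \<A> q B \<and> smooth_field_near M \<A> q W \<and>
     A q = u \<and> B q = v \<and> W q = w \<longrightarrow> ?R = curvature_op M \<A> nab A B W q"
    using curvature_op_near[OF q] by auto
  \<comment> \<open>Extending a vector with constant frame coefficients provides at least one triple
    of smooth extensions, which pins down the described value.\<close>
  let ?ext = "\<lambda>v r. g q v (T q) *\<^sub>R T r + g q v (N q) *\<^sub>R N r"
  have ext: "smooth_field_near M \<A> q (?ext v) \<and> ?ext v q = v" if "v \<in> TS q" for v
    using smooth_field_nearI[OF smooth_comb[OF smooth_fun_on_const[OF U] smooth_fun_on_const[OF U]] q]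
      frame_decomp[OF q that] by auto
  fix z assume "\<forall>A B W. smooth_field_near M \<A> q A \<and> smooth_field_near M \<A> q B \<and>
     smooth_field_near M \<A> q W \<and> A q = u \<and> B q = v \<and> W q = w \<longrightarrow> z = curvature_op M \<A> nab A B W q"
  from this[rule_format, of "?ext u" "?ext v" "?ext w"] ext[OF mem(1)] ext[OF mem(2)] ext[OF mem(3)]
  have z: "z = curvature_op M \<A> nab (?ext u) (?ext v) (?ext w) q" by blast
  have *: "?ext u q = u" "?ext v q = v" "?ext w q = w" using ext mem by blast+
  have "z = (\<kappa> q * (g q (?ext u q) (T q) * g q (?ext v q) (N q) - g q (?ext u q) (N q) * g q (?ext v q) (T q)))
      *\<^sub>R (g q (?ext w q) (N q) *\<^sub>R T q - g q (?ext w q) (T q) *\<^sub>R N q)"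
    unfolding z by (rule curvature_op_near[OF q]) (use ext mem in blast)+
  then show "z = ?R" unfolding * .
qed

text \<open>With x_T, x_N for the frame coefficients of x, the endomorphism is u \<mapsto> \<kappa>
  (u_T v_N - u_N v_T) z with z = w_N T - w_T N. It has rank at most one, and its trace is the scalar
  factor at u = z, namely \<kappa> (v_N w_N + v_T w_T) = \<kappa> g(v, w).\<close>

lemma ricci_tensor_frame:
  assumes q: "q \<in> U" and v: "v \<in> TS q" and w: "w \<in> TS q"
  shows "ricci_tensor M \<A> nab q v w = \<kappa> q * g q v w"
proof -
  note top = U_topspace[OF q] and TN = T_mem[OF q] N_mem[OF q]
  let ?z = "g q w (N q) *\<^sub>R T q - g q w (T q) *\<^sub>R N q"
  have z: "?z \<in> TS q" by (intro TS_diff TS_scale top TN)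
  have gz: "g q ?z (T q) = g q w (N q)" "g q ?z (N q) = - g q w (T q)"
    using q by (simp_all add: frame_simps)
  let ?L = "\<lambda>u. riemann_tensor M \<A> nab q u v w"
  have L: "?L u = (\<kappa> q * (g q u (T q) * g q v (N q) - g q u (N q) * g q v (T q))) *\<^sub>R ?z"
    if "u \<in> TS q" for u by (rule riemann_tensor_frame[OF q that v w])
  have "trace_on (TS q) ?L = g q (?L (T q)) (T q) + g q (?L (N q)) (N q)"
  proof (rule trace_on_TS[OF q])
    fix u u' c assume u: "u \<in> TS q"
    show "?L u \<in> TS q" unfolding L[OF u] by (rule TS_scale[OF top z])
    show "?L (c *\<^sub>R u) = c *\<^sub>R ?L u"
      unfolding L[OF u] L[OF TS_scale[OF top u]] scaleR_scaleR g_scale_left[OF top u TN(1)]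
        g_scale_left[OF top u TN(2)]
      by (rule arg_cong[of _ _ "\<lambda>c. c *\<^sub>R ?z"]) (simp add: algebra_simps)
    assume u': "u' \<in> TS q"
    show "?L (u' + u) = ?L u' + ?L u"
      unfolding L[OF u] L[OF u'] L[OF TS_add[OF top u' u]] scaleR_add_left[symmetric]
        g_add_left[OF top u' u TN(1)] g_add_left[OF top u' u TN(2)]
      by (rule arg_cong[of _ _ "\<lambda>c. c *\<^sub>R ?z"]) (simp add: algebra_simps)
  qed
  also have "\<dots> = \<kappa> q * g q v (N q) * g q w (N q) + \<kappa> q * g q v (T q) * g q w (T q)"
    unfolding L[OF TN(1)] L[OF TN(2)] g_scale_left[OF top z TN(1)] g_scale_left[OF top z TN(2)] gz
      unit_T[OF q] unit_N[OF q] orthogonal[OF q] orthogonal'[OF q] by simp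
  also have "g q v w = g q (g q v (T q) *\<^sub>R T q + g q v (N q) *\<^sub>R N q) w"
    using frame_decomp[OF q v] by simp
  then have "g q v w = g q v (T q) * g q w (T q) + g q v (N q) * g q w (N q)"
    using g_sym[OF top w TN(1)] g_sym[OF top w TN(2)] w by (simp add: g_simps top TN)
  then have "\<kappa> q * g q v (N q) * g q w (N q) + \<kappa> q * g q v (T q) * g q w (T q) = \<kappa> q * g q v w"
    by (simp add: algebra_simps)
  finally show ?thesis by (simp add: ricci_tensor_def)
qed

lemma gauss_curvature_frame:
  assumes q: "q \<in> U"
  shows "gauss_curvature M \<A> g nab q = \<kappa> q"
  unfolding gauss_curvature_def
proof (rule the_equality)
  show "\<forall>v\<in>TS q. \<forall>w\<in>TS q. ricci_tensor M \<A> nab q v w = \<kappa> q * g q v w"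
    using ricci_tensor_frame[OF q] by simp
  fix K assume "\<forall>v\<in>TS q. \<forall>w\<in>TS q. ricci_tensor M \<A> nab q v w = K * g q v w"
  then have "ricci_tensor M \<A> nab q (T q) (T q) = K * g q (T q) (T q)" using T_mem[OF q] by blast
  then show "K = \<kappa> q"
    unfolding ricci_tensor_frame[OF q T_mem[OF q] T_mem[OF q]] unit_T[OF q] by simp
qed

section \<open>The divergences of \<open>T\<close> and \<open>Y\<close> in the frame\<close>

lemma divergence_T: "q \<in> U \<Longrightarrow> divergence M \<A> nab T q = \<omega> q (N q)"
  by (simp add: divergence_frame fields_near nab_T frame_simps)

text \<open>Matches the trace of the covariant derivative of - \<omega>(N) T + \<omega>(T) N term by
  term with \<open>\<kappa>\<close>: each square comes from one diagonal entry, through the rotation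
  of the frame.\<close>

lemma divergence_eq_\<kappa>:
  assumes q: "q \<in> U" and Y: "\<And>r. r \<in> U \<Longrightarrow> Y r = nab r (T r) T - divergence M \<A> nab T r *\<^sub>R T r"
  shows "divergence M \<A> nab Y q = \<kappa> q"
proof -
  note top = U_topspace[OF q] and TN = T_mem[OF q] N_mem[OF q]
  let ?a = "\<lambda>r. \<omega> r (T r)" and ?b = "\<lambda>r. \<omega> r (N r)"
  note a = smooth_\<omega>[OF T] and b = smooth_\<omega>[OF N]
  note mb = smooth_fun_on_minus[OF b]
  have Y': "Y r = (- ?b r) *\<^sub>R T r + ?a r *\<^sub>R N r" if "r \<in> U" for r
    unfolding Y[OF that] nab_T[OF that T_mem[OF that]] divergence_T[OF that] by simp
  have "smooth_field_near M \<A> q Y"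
    by (rule smooth_field_nearI[OF smooth_field_on_cong[OF smooth_comb[OF mb a]] q]) (simp add: Y')
  note div = divergence_frame[OF q this]
  have minus: "T q (\<lambda>r. - ?b r) = - T q ?b"
    using tangent_mult[OF TN(1) smooth_fun_nearI[OF smooth_fun_on_const[OF U] q] smooth_fun_nearI[OF b q], of "-1"]
      tangent_const[OF TN(1), of "-1"] by simp
  have nabY: "nab q v Y = (v (\<lambda>r. - ?b r) - ?a q * \<omega> q v) *\<^sub>R T q + (v ?a + - ?b q * \<omega> q v) *\<^sub>R N q"
    if "v \<in> TS q" for v
    by (rule nab_eq_comb[OF q that mb a]) (rule Y')
  show ?thesis
    unfolding div nabY[OF TN(1)] nabY[OF TN(2)] g_comb[OF q] minus
    by (simp add: \<kappa>_def power2_eq_square)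
qed

end


section \<open>Local existence of orthonormal frames\<close>

context riemannian_surface
begin

text \<open>Gram-Schmidt: a coordinate field \<open>E\<close> with constant coordinate vector is
  made orthogonal to \<open>T\<close>, giving \<open>F\<close>, and then normalized where it does
  not vanish.\<close>

lemma ex_orthonormal_frame:
  assumes T: "smooth_field_on M \<A> U T" and unit: "\<And>q. q \<in> U \<Longrightarrow> g q (T q) (T q) = 1" and p: "p \<in> U"
  shows "\<exists>R N. p \<in> R \<and> orthonormal_frame M \<A> g nab R T N"
proof -
  note U = smooth_field_on_openin[OF T]
  have top: "q \<in> topspace M" if "q \<in> U" for q using openin_subset[OF U] that by blast
  obtain D \<phi> where D: "(D, \<phi>) \<in> \<A>" "p \<in> D" using chart_at[OF top[OF p]] by blast
  let ?L = "chart_tvec M \<A> (D, \<phi>) p"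
  have lin: "linear ?L" by (rule linear_chart_tvec[OF D])
  obtain t where t: "T p = ?L t"
    using smooth_field_onD(1)[OF T p] tangent_space_eq_range[OF D] by auto
  \<comment> \<open>The model space has dimension two, so some direction \<open>e\<close> lies off
    the line of the coordinate vector of \<open>T p\<close>.\<close>
  have "span {t} \<noteq> (UNIV :: (real^2) set)"
  proof
    assume "span {t} = (UNIV :: (real^2) set)"
    then have "dim (UNIV :: (real^2) set) \<le> card {t}" by (intro span_card_ge_dim) auto
    then show False by simp
  qed
  then obtain e where e: "e \<notin> span {t}" by blast
  let ?O = "U \<inter> D"
  have O: "openin M ?O" by (rule openin_Int[OF U chart_openin[OF D(1)]])
  define E where "E = (\<lambda>q. chart_tvec M \<A> (D, \<phi>) q e)"
  have E: "smooth_field_on M \<A> ?O E" unfolding E_def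
    by (rule smooth_field_on_subset[OF smooth_field_on_chart_tvec[OF D(1)] O]) auto
  have TO: "smooth_field_on M \<A> ?O T" by (rule smooth_field_on_subset[OF T O]) auto
  define F where "F = (\<lambda>q. E q + (- g q (E q) (T q)) *\<^sub>R T q)"
  have F: "smooth_field_on M \<A> ?O F" unfolding F_def
    by (intro smooth_field_on_add smooth_field_on_scale smooth_fun_on_minus smooth_fun_on_metric E TO)
  note mem = smooth_field_onD(1)[OF TO] smooth_field_onD(1)[OF E] smooth_field_onD(1)[OF F]
  \<comment> \<open>\<open>E\<close> is known to be independent of \<open>T\<close> only at
    \<open>p\<close>; away from \<open>p\<close> the field \<open>F\<close> may vanish, so the
    domain is cut down to where it has positive length.\<close>
  define R where "R = {q \<in> ?O. g q (F q) (F q) > 0}"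
  have R: "openin M R" unfolding R_def by (rule openin_smooth_fun_pos[OF smooth_fun_on_metric[OF F F]])
  have RO: "R \<subseteq> ?O" unfolding R_def by blast
  note FR = smooth_field_on_subset[OF F R RO]
  define N where "N = (\<lambda>q. (1 / sqrt (g q (F q) (F q))) *\<^sub>R F q)"
  \<comment> \<open>If \<open>F p\<close> vanished, \<open>E p\<close> would be a multiple of
    \<open>T p\<close>; injectivity of the chart representation would carry this relation back to
    \<open>e\<close> and \<open>t\<close>.\<close>
  have "F p \<noteq> 0"
  proof
    assume "F p = 0"
    then have "E p = g p (E p) (T p) *\<^sub>R T p" by (simp add: F_def)
    also have "\<dots> = ?L (g p (E p) (T p) *\<^sub>R t)" by (simp add: t linear_cmul[OF lin])
    finally have "?L e = ?L (g p (E p) (T p) *\<^sub>R t)" by (simp add: E_def)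
    from injD[OF inj_chart_tvec[OF D] this] have "e = g p (E p) (T p) *\<^sub>R t" .
    also have "\<dots> \<in> span {t}" by (intro span_scale span_base) simp
    finally show False using e by simp
  qed
  then have pR: "p \<in> R" using g_pos[OF top[OF p] mem(3)] p D(2) by (simp add: R_def)
  have "orthonormal_frame M \<A> g nab R T N"
  proof
    show "smooth_field_on M \<A> R T" by (rule smooth_field_on_subset[OF TO R RO])
    show "smooth_field_on M \<A> R N" unfolding N_def
      by (intro smooth_field_on_scale FR smooth_fun_on_inverse_sqrt smooth_fun_on_metric)
        (simp add: R_def)
    fix q assume q: "q \<in> R"
    then have qO: "q \<in> ?O" and pos: "g q (F q) (F q) > 0" by (auto simp: R_def)
    then have qU: "q \<in> U" by simp
    note m = mem[OF qO]
    show "g q (T q) (T q) = 1" by (rule unit[OF qU])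
    show "g q (N q) (N q) = 1"
      unfolding N_def g_scale_left[OF top[OF qU] m(3) TS_scale[OF top[OF qU] m(3)]]
        g_scale_right[OF top[OF qU] m(3) m(3)] using pos by simp
    have "g q (T q) (F q) = g q (T q) (E q) - g q (E q) (T q)"
      unfolding F_def g_add_right[OF top[OF qU] m(2) TS_scale[OF top[OF qU] m(1)] m(1)]
        g_scale_right[OF top[OF qU] m(1) m(1)] unit[OF qU] by simp
    then show "g q (T q) (N q) = 0"
      unfolding N_def g_scale_right[OF top[OF qU] m(3) m(1)] using g_sym[OF top[OF qU] m(1,2)] by simp
  qed
  with pR show ?thesis by blast
qed

end

section \<open>Gluing the local frame computations on \<open>M0\<close>\<close>

theorem mainTheorem2:
  fixes M :: "'m topology"
    and \<A> :: "('m, real^2) chart set"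
    and g :: "'m \<Rightarrow> 'm tvec \<Rightarrow> 'm tvec \<Rightarrow> real"
    and nab :: "'m connection"
    and X T Y :: "'m \<Rightarrow> 'm tvec"
    and M0 :: "'m set"
  assumes "smooth_manifold M \<A>"
    and "riemannian_metric M \<A> g"
    and "levi_civita_connection M \<A> g nab"
    and "smooth_field_on M \<A> (topspace M) X"
    and "\<exists>x\<in>topspace M. X x \<noteq> 0"
    and "M0 = {x \<in> topspace M. X x \<noteq> 0}"
    and "\<And>x. x \<in> M0 \<Longrightarrow> T x = (1 / sqrt (g x (X x) (X x))) *\<^sub>R X x"
    and "\<And>x. x \<in> M0 \<Longrightarrow> Y x = nab x (T x) T - divergence M \<A> nab T x *\<^sub>R T x"
  shows "openin M M0 \<and>
    smooth_field_on M \<A> M0 T \<and> (\<forall>x\<in>M0. g x (T x) (T x) = 1) \<and>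
    smooth_field_on M \<A> M0 Y \<and>
    (\<forall>x\<in>M0. gauss_curvature M \<A> g nab x = divergence M \<A> nab Y x)"
proof -
  interpret riemannian_surface M \<A> g nab by unfold_locales (fact assms(1-3))+
  note X = assms(4) and T_eq = assms(7) and Y_eq = assms(8)
  note memX = smooth_field_onD(1)[OF X]
  have pos: "X x \<noteq> 0 \<longleftrightarrow> g x (X x) (X x) > 0" if "x \<in> topspace M" for x
    using g_pos[OF that memX[OF that]] g_zero[OF that memX[OF that]] by auto
  \<comment> \<open>Rewriting the nonvanishing of \<open>X\<close> as positivity of a smooth
    function gives both openness of \<open>M0\<close> and the smooth normalization of
    \<open>X\<close>.\<close>
  have M0_eq: "M0 = {x \<in> topspace M. g x (X x) (X x) > 0}" using pos assms(6) by blast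
  have M0: "openin M M0" unfolding M0_eq
    by (rule openin_smooth_fun_pos[OF smooth_fun_on_metric[OF X X]])
  have M0_top: "M0 \<subseteq> topspace M" by (rule openin_subset[OF M0])
  note X0 = smooth_field_on_subset[OF X M0 M0_top]
  have posX: "g x (X x) (X x) > 0" if "x \<in> M0" for x using that M0_eq by simp
  have T: "smooth_field_on M \<A> M0 T"
  proof (rule smooth_field_on_cong)
    show "smooth_field_on M \<A> M0 (\<lambda>x. (1 / sqrt (g x (X x) (X x))) *\<^sub>R X x)"
      by (intro smooth_field_on_scale X0 smooth_fun_on_inverse_sqrt smooth_fun_on_metric posX)
  qed (simp add: T_eq)
  have unit: "g x (T x) (T x) = 1" if x: "x \<in> M0" for x
  proof -
    have top: "x \<in> topspace M" using x M0_top by blast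
    show ?thesis
      unfolding T_eq[OF x] g_scale_left[OF top memX[OF top] TS_scale[OF top memX[OF top]]]
        g_scale_right[OF top memX[OF top] memX[OF top]] using posX[OF x] by simp
  qed
  \<comment> \<open>\<open>divergence\<close> is a pointwise trace, from which smoothness cannot be
    read off; near each point it equals the smooth function \<omega>(N) of a local frame.\<close>
  have "smooth_fun_on M \<A> M0 (\<lambda>x. divergence M \<A> nab T x)"
  proof (rule smooth_fun_on_local[OF M0])
    fix p assume "p \<in> M0"
    then obtain R N where R: "p \<in> R" "orthonormal_frame M \<A> g nab R T N"
      using ex_orthonormal_frame[OF T unit] by blast
    interpret orthonormal_frame M \<A> g nab R T N by (rule R(2))
    have "smooth_fun_on M \<A> R (\<lambda>x. divergence M \<A> nab T x)"
      by (rule smooth_fun_on_cong[OF smooth_\<omega>[OF N]]) (simp add: divergence_T)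
    with R(1) show "\<exists>V. p \<in> V \<and> smooth_fun_on M \<A> V (\<lambda>x. divergence M \<A> nab T x)" by blast
  qed
  then have "smooth_field_on M \<A> M0 (\<lambda>x. nab x (T x) T + (- divergence M \<A> nab T x) *\<^sub>R T x)"
    by (intro smooth_field_on_add smooth_field_on_nab smooth_field_on_scale smooth_fun_on_minus T)
  then have Y: "smooth_field_on M \<A> M0 Y"
    by (rule smooth_field_on_cong) (simp add: Y_eq)
  have "gauss_curvature M \<A> g nab p = divergence M \<A> nab Y p" if p: "p \<in> M0" for p
  proof -
    from ex_orthonormal_frame[OF T unit p] obtain R' N where
      R': "p \<in> R'" "orthonormal_frame M \<A> g nab R' T N" by blast
    \<comment> \<open>The frame domain is not known to lie inside \<open>M0\<close>, where alone
      \<open>Y\<close> is prescribed, hence the intersection.\<close>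
    let ?R = "R' \<inter> M0"
    have "openin M R'" using R'(2) orthonormal_frame.U by blast
    then interpret orthonormal_frame M \<A> g nab ?R T N
      by (intro orthonormal_frame_subset[OF R'(2)] openin_Int M0) auto
    have pR: "p \<in> ?R" using p R'(1) by simp
    show ?thesis unfolding gauss_curvature_frame[OF pR]
      by (rule divergence_eq_\<kappa>[symmetric, OF pR]) (rule Y_eq, simp)
  qed
  with M0 T unit Y show ?thesis by blast
qed

end
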